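(* Let $(\overline{K}(X)|K,v)$ be an extension of valued fields. Assume that $(K(X)|K,v)$ is valuation transcendental and that $vK$ is cofinal in $vK(X)$. Let $\widehat{K}$ be the completion of $(K,v)$ and fix an extension of $v$ to $\overline{\widehat{K}}$. Take a complete sequence of key polynomials $\{Q_\nu\}_{\nu\in\Lambda}$ for $v$ over $K$. Then $\{Q_\nu\}_{\nu\in\Lambda}$ forms a complete sequence of key polynomials for the induced extension $(\widehat{K}(X)|\widehat{K},v)$.
   Context: Valuations are Krull valuations written additively; $vL$, $Lv$ denote value group and residue field. $(K,v)$ is dense in $(L,v)$ if for every $a\in L$, $\gamma\in vL$ there is $b\in K$ with $v(a-b)>\gamma$; the completion $(\widehat{K},v)$ is the maximal extension in which $(K,v)$ is dense. $\overline{K}\subseteq\overline{\widehat{K}}$ are algebraic closures; the extension of $v$ to $\overline{\widehat{K}}$ is understood to extend both the valuation of $\widehat{K}$ and the given one on $\overline{K}$. $(K(X)|K,v)$ is value transcendental if $\dim_{\mathbb{Q}}\big((vK(X)/vK)\otimes\mathbb{Q}\big)=1$, residue transcendental if $\mathrm{trdeg}[K(X)v:Kv]=1$, and valuation transcendental if it is one of these. For $a\in\overline{F}$ and $\gamma$ in an ordered abelian group containing $v\overline{F}$, $v_{a,\gamma}$ is the valuation on $\overline{F}(X)$ with $v_{a,\gamma}\big(\sum C_i(X-a)^i\big)=\min_i\{vC_i+i\gamma\}$. A pair $(a,\gamma)\in\overline{F}\times v\overline{F}(X)$ is a pair of definition for a valuation $v$ on $\overline{F}(X)$ over $F$ if $v=v_{a,\gamma}$;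 such a pair exists when $(F(X)|F,v)$ is valuation transcendental. The induced extension: take a pair of definition $(a,\gamma)$ for $v$ over $K$; the valuation $v_{a,\gamma}$ on $\overline{\widehat{K}}(X)$ (formed from $v$ on $\overline{\widehat{K}}$) extends $v$ on $\overline{K}(X)$, does not depend on the choice of pair, and its restriction to $\widehat{K}(X)$, again denoted $v$, gives the induced extension $(\widehat{K}(X)|\widehat{K},v)$. Key polynomials (for a valuation $v$ on $\overline{F}(X)$, over a base field $F$; for the induced extension use $F=\widehat{K}$ and the induced valuation on $\overline{\widehat{K}}(X)$): for nonconstant $f\in F[X]$ put $\delta(f):=\max\{v(X-a)\mid a\in\overline{F}\text{ a root of }f\}$. A nonconstant monic $Q\in F[X]$ is a key polynomial for $v$ over $F$ if $\delta(f)<\delta(Q)$ for every nonconstant $f\in F[X]$ with $\deg f<\deg Q$. For such $Q$ and $f=\sum f_iQ^i$ with $\deg f_i<\deg Q$, put $v_Q(f):=\min_i\{vf_i+i\,vQ\}$. A family $\Lambda$ of key polynomials for $v$ over $F$ is a complete sequence of key polynomials for $v$ over $F$ if: (1) $\delta(Q)\ne\delta(Q')$ for distinct $Q,Q'\in\Lambda$; (2) $\Lambda$ is well ordered by $Q<Q'\iff\delta(Q)<\delta(Q')$; (3) for every nonconstant $f\in F[X]$ there is $Q\in\Lambda$ with $\deg Q\le\deg f$ and $vf=v_Qf$. *)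

theory Defs
  imports "HOL-Library.Extended" "HOL-Algebra.Algebra" "HOL-Algebra.Algebraic_Closure_Type"
begin

section \<open>Valued fields\<close>

text \<open>
  All fields live inside one algebraically closed ambient type and are given by their carrier
  sets; \<open>field_on F\<close> is the corresponding ring record.
\<close>

abbreviation field_on :: "'a::field set \<Rightarrow> 'a ring" where
  "field_on F \<equiv> ring_of_type_algebra\<lparr>carrier := F\<rparr>"

text \<open>
  The type \<open>extended\<close> also has a least element, which a valuation must not attain.
\<close>

definition krull_valuation ::
  "('a, 'm) ring_scheme \<Rightarrow> ('a \<Rightarrow> 'g::linordered_ab_group_add extended) \<Rightarrow> bool" where
  "krull_valuation R v \<longleftrightarrow>
     (\<forall>x\<in>carrier R. v x \<noteq> -\<infinity> \<and> (v x = \<infinity> \<longleftrightarrow> x = \<zero>\<^bsub>R\<^esub>)) \<and>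
     (\<forall>x\<in>carrier R. \<forall>y\<in>carrier R. v (x \<otimes>\<^bsub>R\<^esub> y) = v x + v y) \<and>
     (\<forall>x\<in>carrier R. \<forall>y\<in>carrier R. min (v x) (v y) \<le> v (x \<oplus>\<^bsub>R\<^esub> y))"

definition value_group :: "('a \<Rightarrow> 'g extended) \<Rightarrow> 'a set \<Rightarrow> 'g set" where
  "value_group v L = {\<gamma>. \<exists>x\<in>L. v x = Fin \<gamma>}"

definition valuation_ring ::
  "('a, 'm) ring_scheme \<Rightarrow> ('a \<Rightarrow> 'g::linordered_ab_group_add extended) \<Rightarrow> ('a, 'm) ring_scheme" where
  "valuation_ring R v = R\<lparr>carrier := {x \<in> carrier R. 0 \<le> v x}\<rparr>"

definition valuation_ideal ::
  "('a, 'm) ring_scheme \<Rightarrow> ('a \<Rightarrow> 'g::linordered_ab_group_add extended) \<Rightarrow> 'a set" where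
  "valuation_ideal R v = {x \<in> carrier R. 0 < v x}"

definition residue_field ::
  "('a, 'm) ring_scheme \<Rightarrow> ('a \<Rightarrow> 'g::linordered_ab_group_add extended) \<Rightarrow> 'a set ring" where
  "residue_field R v = valuation_ring R v Quot valuation_ideal R v"

text \<open>The residue field of a subfield \<open>S\<close> of \<open>R\<close>, as a subset of that of \<open>R\<close>.\<close>

definition residues ::
  "('a, 'm) ring_scheme \<Rightarrow> ('a \<Rightarrow> 'g::linordered_ab_group_add extended) \<Rightarrow> 'a set \<Rightarrow> 'a set set" where
  "residues R v S =
     (\<lambda>x. valuation_ideal R v +>\<^bsub>valuation_ring R v\<^esub> x) ` {x \<in> S. 0 \<le> v x}"

definition dense_in ::
  "'a set \<Rightarrow> ('a, 'm) ring_scheme \<Rightarrow> ('a \<Rightarrow> 'g::linordered_ab_group_add extended) \<Rightarrow> bool" where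
  "dense_in S R v \<longleftrightarrow>
     (\<forall>a\<in>carrier R. \<forall>\<gamma>\<in>value_group v (carrier R). \<exists>b\<in>S. v (a \<ominus>\<^bsub>R\<^esub> b) > Fin \<gamma>)"

text \<open>
  Maximality: \<open>(L, v)\<close> has no proper valued field extension \<open>(R, u)\<close> in which \<open>K\<close> is dense.
  Letting \<open>R\<close> range over fields with carrier in \<open>'c set\<close> and \<open>u\<close> over valuations with values in
  \<open>'g\<close> is no restriction: an element \<open>x\<close> of such an \<open>R\<close> is determined by the set of pairs
  \<open>(b, c)\<close> in \<open>K \<times> K\<close> with \<open>u (x - b) \<ge> v c\<close>, the infinite type \<open>'c\<close> is equipotent to
  \<open>'c \<times> 'c\<close>, and \<open>u\<close> has the same value group as \<open>v\<close> on \<open>K\<close> because \<open>K\<close> is dense.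
\<close>

definition completion ::
  "'c::alg_closed_field set \<Rightarrow> 'c set \<Rightarrow> ('c \<Rightarrow> 'g::linordered_ab_group_add extended) \<Rightarrow> bool" where
  "completion K L v \<longleftrightarrow>
     subfield L ring_of_type_algebra \<and> K \<subseteq> L \<and> krull_valuation (field_on L) v \<and>
     dense_in K (field_on L) v \<and>
     (\<forall>(R :: 'c set ring) u \<phi>.
        field R \<and> krull_valuation R (u :: 'c set \<Rightarrow> 'g extended) \<and>
        \<phi> \<in> ring_hom (field_on L) R \<and> (\<forall>x\<in>L. u (\<phi> x) = v x) \<and>
        dense_in (\<phi> ` K) R u \<longrightarrow> \<phi> ` L = carrier R)"


section \<open>Subfields of the ambient field and their rational function fields\<close>

definition polys_over :: "'c::field set \<Rightarrow> 'c poly set" where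
  "polys_over F = {p. \<forall>i. Polynomial.coeff p i \<in> F}"

definition alg_cl :: "'c::field set \<Rightarrow> 'c set" where
  "alg_cl F = {x. \<exists>p\<in>polys_over F. p \<noteq> 0 \<and> poly p x = 0}"

definition of_const :: "'c::field \<Rightarrow> 'c poly fract" where
  "of_const c = to_fract [:c:]"

definition ratfuns :: "'c::field set \<Rightarrow> 'c poly fract set" where
  "ratfuns F = {Fraction_Field.Fract p q | p q. p \<in> polys_over F \<and> q \<in> polys_over F \<and> q \<noteq> 0}"


section \<open>Valuation transcendental extensions\<close>

definition add_group_on :: "'a::monoid_add set \<Rightarrow> 'a monoid" where
  "add_group_on A = \<lparr>carrier = A, monoid.mult = (+), one = 0\<rparr>"

definition tensor_free :: "('a, 'm) monoid_scheme \<Rightarrow> ('b, 'n) monoid_scheme \<Rightarrow> ('a \<times> 'b \<Rightarrow>\<^sub>0 int) monoid" where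
  "tensor_free G H = free_Abelian_group (carrier G \<times> carrier H)"

definition tensor_relations ::
  "('a, 'm) monoid_scheme \<Rightarrow> ('b, 'n) monoid_scheme \<Rightarrow> ('a \<times> 'b \<Rightarrow>\<^sub>0 int) set" where
  "tensor_relations G H = generate (tensor_free G H)
     ({frag_of (x \<otimes>\<^bsub>G\<^esub> x', y) - frag_of (x, y) - frag_of (x', y) | x x' y.
         x \<in> carrier G \<and> x' \<in> carrier G \<and> y \<in> carrier H} \<union>
      {frag_of (x, y \<otimes>\<^bsub>H\<^esub> y') - frag_of (x, y) - frag_of (x, y') | x y y'.
         x \<in> carrier G \<and> y \<in> carrier H \<and> y' \<in> carrier H})"

text \<open>Tensor product over the integers of two abelian groups, written multiplicatively.\<close>

definition tensor ::
  "('a, 'm) monoid_scheme \<Rightarrow> ('b, 'n) monoid_scheme \<Rightarrow> ('a \<times> 'b \<Rightarrow>\<^sub>0 int) set monoid" where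
  "tensor G H = tensor_free G H Mod tensor_relations G H"

abbreviation rat_group :: "rat monoid" where
  "rat_group \<equiv> add_group_on UNIV"

text \<open>
  Scalar multiplication on \<open>G \<otimes> \<rat>\<close>, sending the class of \<open>(x, r)\<close> to that of \<open>(x, q * r)\<close>.
  Multiplying by the relations turns the image of a coset into a full coset also for \<open>q = 0\<close>.
\<close>

definition rat_scale ::
  "('a, 'm) monoid_scheme \<Rightarrow> rat \<Rightarrow> ('a \<times> rat \<Rightarrow>\<^sub>0 int) set \<Rightarrow> ('a \<times> rat \<Rightarrow>\<^sub>0 int) set" where
  "rat_scale G q C = tensor_relations G rat_group <#>\<^bsub>tensor_free G rat_group\<^esub>
     frag_extend (\<lambda>(x, r). frag_of (x, q * r)) ` C"

text \<open>\<open>G \<otimes> \<rat>\<close> has a \<open>\<rat>\<close>-basis consisting of one element.\<close>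

definition rational_rank_one :: "('a, 'm) monoid_scheme \<Rightarrow> bool" where
  "rational_rank_one G \<longleftrightarrow>
     (\<exists>t\<in>carrier (tensor G rat_group). \<forall>u\<in>carrier (tensor G rat_group). \<exists>!q. u = rat_scale G q t)"

text \<open>
  A transcendence basis is a set none of whose elements is algebraic over the field generated by
  the others, and over which everything is algebraic.
\<close>

definition has_trdeg :: "('a, 'm) ring_scheme \<Rightarrow> 'a set \<Rightarrow> nat \<Rightarrow> bool" where
  "has_trdeg R k n \<longleftrightarrow>
     (\<exists>B \<subseteq> carrier R. finite B \<and> card B = n \<and>
        (\<forall>b\<in>B. ring.transcendental R (generate_field R (k \<union> (B - {b}))) b) \<and>
        (\<forall>x\<in>carrier R. ring.algebraic R (generate_field R (k \<union> B)) x))"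

definition value_transcendental ::
  "'c::field set \<Rightarrow> ('c poly fract \<Rightarrow> 'g::linordered_ab_group_add extended) \<Rightarrow> bool" where
  "value_transcendental K v \<longleftrightarrow>
     rational_rank_one
       (add_group_on (value_group v (ratfuns K)) Mod value_group v (of_const ` K))"

definition residue_transcendental ::
  "'c::field set \<Rightarrow> ('c poly fract \<Rightarrow> 'g::linordered_ab_group_add extended) \<Rightarrow> bool" where
  "residue_transcendental K v \<longleftrightarrow>
     has_trdeg (residue_field (field_on (ratfuns K)) v)
       (residues (field_on (ratfuns K)) v (of_const ` K)) 1"

definition valuation_transcendental ::
  "'c::field set \<Rightarrow> ('c poly fract \<Rightarrow> 'g::linordered_ab_group_add extended) \<Rightarrow> bool" where
  "valuation_transcendental K v \<longleftrightarrow> value_transcendental K v \<or> residue_transcendental K v"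


section \<open>Pairs of definition and the induced valuation\<close>

definition nsmul :: "nat \<Rightarrow> 'a::comm_monoid_add \<Rightarrow> 'a" where
  "nsmul n x = (\<Sum>i<n. x)"

text \<open>The coefficients of the expansion of \<open>f\<close> in powers of \<open>X - a\<close> are those of \<open>f (X + a)\<close>.\<close>

definition gauss_poly ::
  "('c::field \<Rightarrow> 'g::linordered_ab_group_add extended) \<Rightarrow> 'c \<Rightarrow> 'g \<Rightarrow> 'c poly \<Rightarrow> 'g extended" where
  "gauss_poly w a \<gamma> f =
     Min ((\<lambda>i. w (Polynomial.coeff (pcompose f [:a, 1:]) i) + Fin (nsmul i \<gamma>)) `
          {..Polynomial.degree f})"

text \<open>
  The valuation \<open>v\<^bsub>a,\<gamma>\<^esub>\<close> on the rational function field over \<open>E\<close>, where \<open>w\<close> is a valuation on \<open>E\<close>.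
\<close>

definition gauss_val ::
  "'c::field set \<Rightarrow> ('c \<Rightarrow> 'g::linordered_ab_group_add extended) \<Rightarrow> 'c \<Rightarrow> 'g \<Rightarrow>
   'c poly fract \<Rightarrow> 'g extended" where
  "gauss_val E w a \<gamma> r =
     (THE m. \<exists>p\<in>polys_over E. \<exists>q\<in>polys_over E. q \<noteq> 0 \<and> r = Fraction_Field.Fract p q \<and>
        m = gauss_poly w a \<gamma> p - gauss_poly w a \<gamma> q)"

definition pair_of_definition ::
  "'c::field set \<Rightarrow> ('c poly fract \<Rightarrow> 'g::linordered_ab_group_add extended) \<Rightarrow> 'c \<times> 'g \<Rightarrow> bool" where
  "pair_of_definition F v = (\<lambda>(a, \<gamma>).
     a \<in> alg_cl F \<and> \<gamma> \<in> value_group v (ratfuns (alg_cl F)) \<and>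
     (\<forall>r\<in>ratfuns (alg_cl F). v r = gauss_val (alg_cl F) (\<lambda>c. v (of_const c)) a \<gamma> r))"

text \<open>
  Here \<open>w\<close> is the extension of \<open>v\<close> to the algebraic closure of \<open>L\<close>, the completion of \<open>K\<close>.
\<close>

definition induced_valuation ::
  "'c::field set \<Rightarrow> ('c poly fract \<Rightarrow> 'g::linordered_ab_group_add extended) \<Rightarrow>
   'c set \<Rightarrow> ('c \<Rightarrow> 'g extended) \<Rightarrow> 'c poly fract \<Rightarrow> 'g extended" where
  "induced_valuation K v L w =
     (case (SOME ag. pair_of_definition K v ag) of (a, \<gamma>) \<Rightarrow> gauss_val (alg_cl L) w a \<gamma>)"


section \<open>Key polynomials\<close>

definition nonconst_polys :: "'c::field set \<Rightarrow> 'c poly set" where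
  "nonconst_polys F = {f \<in> polys_over F. Polynomial.degree f > 0}"

definition delta ::
  "'c::field set \<Rightarrow> ('c poly fract \<Rightarrow> 'g::linordered_ab_group_add extended) \<Rightarrow>
   'c poly \<Rightarrow> 'g extended" where
  "delta F v f = Max {v (to_fract [:-a, 1:]) | a. a \<in> alg_cl F \<and> poly f a = 0}"

definition key_polynomial ::
  "'c::field set \<Rightarrow> ('c poly fract \<Rightarrow> 'g::linordered_ab_group_add extended) \<Rightarrow>
   'c poly \<Rightarrow> bool" where
  "key_polynomial F v Q \<longleftrightarrow>
     Q \<in> nonconst_polys F \<and> Polynomial.lead_coeff Q = 1 \<and>
     (\<forall>f\<in>nonconst_polys F. Polynomial.degree f < Polynomial.degree Q \<longrightarrow>
        delta F v f < delta F v Q)"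

text \<open>The truncation \<open>v\<^sub>Q\<close>; zero terms in the expansion contribute \<open>\<infinity>\<close>, so \<open>n\<close> may be any bound.\<close>

definition truncation ::
  "'c::field set \<Rightarrow> ('c poly fract \<Rightarrow> 'g::linordered_ab_group_add extended) \<Rightarrow>
   'c poly \<Rightarrow> 'c poly \<Rightarrow> 'g extended" where
  "truncation F v Q f =
     (THE m. \<exists>n fs.
        (\<forall>i\<le>n. fs i \<in> polys_over F \<and> Polynomial.degree (fs i) < Polynomial.degree Q) \<and>
        f = (\<Sum>i\<le>n. fs i * Q ^ i) \<and>
        m = Min ((\<lambda>i. v (to_fract (fs i)) + nsmul i (v (to_fract Q))) ` {..n}))"

definition complete_sequence ::
  "'c::field set \<Rightarrow> ('c poly fract \<Rightarrow> 'g::linordered_ab_group_add extended) \<Rightarrow>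
   'c poly set \<Rightarrow> bool" where
  "complete_sequence F v \<Lambda> \<longleftrightarrow>
     (\<forall>Q\<in>\<Lambda>. key_polynomial F v Q) \<and>
     inj_on (delta F v) \<Lambda> \<and>
     well_order_on \<Lambda> {(Q, Q'). Q \<in> \<Lambda> \<and> Q' \<in> \<Lambda> \<and> (Q = Q' \<or> delta F v Q < delta F v Q')} \<and>
     (\<forall>f\<in>nonconst_polys F. \<exists>Q\<in>\<Lambda>. Polynomial.degree Q \<le> Polynomial.degree f \<and>
        v (to_fract f) = truncation F v Q f)"

end

theory Submission
  imports Defs
begin

text \<open>
  Write \<open>\<omega>\<^sub>a\<close> for the Gauss valuation with center \<open>a\<close> and radius \<open>\<gamma> = v (X - a)\<close>. It sends \<open>X - b\<close> to
  \<open>min (v (X - b)) \<gamma>\<close>, so on a product of linear factors it agrees with \<open>v\<close> exactly if every root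
  \<open>b\<close> satisfies \<open>v (X - b) \<le> \<gamma>\<close>. In particular a center \<open>a\<close> that maximizes \<open>v (X - a)\<close> gives a pair of
  definition; if there were no maximum, every rational function would have the same leading term as
  an algebraic constant, and the extension would be neither value nor residue transcendental.

  If \<open>Q\<close> is a key polynomial and \<open>a\<close> a root with \<open>v (X - a) = \<delta>(Q)\<close>, then the truncation \<open>v\<^sub>Q\<close> is the
  restriction of \<open>\<omega>\<^sub>a\<close>. Hence \<open>v f = v\<^sub>Q f\<close> if and only if \<open>\<delta>(f) \<le> \<delta>(Q)\<close>, and completeness of a family
  only says that each \<open>\<delta>(f)\<close> is dominated by some \<open>\<delta>(Q)\<close> with \<open>deg Q \<le> deg f\<close>. Since \<open>vK\<close> is cofinal
  and \<open>K\<close> is dense in its completion, continuity of roots provides for every \<open>f\<close> over the completion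
  a polynomial \<open>g\<close> over \<open>K\<close> of the same degree with \<open>\<delta>(f) \<le> \<delta>(g)\<close>, which transfers both the key
  polynomial property and completeness.
\<close>

section \<open>Subfields and their algebraic closures\<close>

text \<open>The radius sets the precision. The induced valuation of X - b is
  \<open>min (w (a - b)) \<gamma>\<close>, so moving a root by anything of value beyond \<gamma>
  does not lower it. For f of degree n over the completion it is therefore enough to have a monic g
  of degree n over K whose value at the maximizing root b of f exceeds n \<gamma>: this value is the
  sum of the values of b - b' over the roots b' of g, so one of them exceeds \<gamma>.

  The obstacle is that \<gamma> is a value of rational functions over the algebraic closure, while
  density speaks only of values attained on the completion. Hence \<gamma> must be bounded by a
  value of K. Cofinality gives this for values of K(X), and a polynomial over K that vanishes at the
  center a carries the bound over to \<gamma>.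

  A second obstacle is that Q-adic expansions over the completion have digits that do not exist over
  K. Expressing truncations through \<delta> removes the expansions from the comparison, because
  \<delta> of a polynomial over K is the same for both valuations.\<close>

lemma type_algebra_simps:
  "carrier (ring_of_type_algebra :: 'a::field ring) = UNIV"
  "\<zero>\<^bsub>(ring_of_type_algebra :: 'a ring)\<^esub> = 0"
  "\<one>\<^bsub>(ring_of_type_algebra :: 'a ring)\<^esub> = 1"
  "x \<otimes>\<^bsub>(ring_of_type_algebra :: 'a ring)\<^esub> y = x * y"
  "x \<oplus>\<^bsub>(ring_of_type_algebra :: 'a ring)\<^esub> y = x + y"
  by (simp_all add: ring_of_type_algebra_def)

lemma type_algebra_a_inv: "\<ominus>\<^bsub>(ring_of_type_algebra :: 'a::field ring)\<^esub> x = - x"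
  by (rule abelian_group.minus_equality[OF ring.is_abelian_group[OF ring_from_type_algebra], of _ x])
     (auto simp: type_algebra_simps)

lemma type_algebra_m_inv:
  assumes "x \<noteq> 0"
  shows "inv\<^bsub>(ring_of_type_algebra :: 'a::field ring)\<^esub> x = inverse x"
  by (rule comm_monoid.comm_inv_char[OF cring.axioms(2)[OF cring_from_type_algebra]])
     (use assms in \<open>auto simp: type_algebra_simps\<close>)

lemma type_algebra_pow: "x [^]\<^bsub>(ring_of_type_algebra :: 'a::field ring)\<^esub> (n::nat) = x ^ n"
  by (induction n) (auto simp: type_algebra_simps)

text \<open>Subfields are phrased with the type class operations so that \<open>poly\<close> and its
  library apply directly. Since \<open>inverse 0 = 0\<close>, closure under inverses carries no side
  condition.\<close>

locale field_set =
  fixes F :: "'a::field set"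
  assumes zero_mem [simp]: "0 \<in> F" and one_mem [simp]: "1 \<in> F"
    and add_mem: "x \<in> F \<Longrightarrow> y \<in> F \<Longrightarrow> x + y \<in> F"
    and uminus_mem: "x \<in> F \<Longrightarrow> - x \<in> F"
    and mult_mem: "x \<in> F \<Longrightarrow> y \<in> F \<Longrightarrow> x * y \<in> F"
    and inverse_mem: "x \<in> F \<Longrightarrow> inverse x \<in> F"
begin

lemma diff_mem: "x \<in> F \<Longrightarrow> y \<in> F \<Longrightarrow> x - y \<in> F"
  using add_mem[of x "- y"] uminus_mem[of y] by simp

lemma power_mem: "x \<in> F \<Longrightarrow> x ^ n \<in> F"
  by (induction n) (auto intro: mult_mem)

lemma sum_mem: "(\<And>i. i \<in> A \<Longrightarrow> f i \<in> F) \<Longrightarrow> sum f A \<in> F"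
  by (induction A rule: infinite_finite_induct) (auto intro: add_mem)

lemma poly_mem: "p \<in> polys_over F \<Longrightarrow> x \<in> F \<Longrightarrow> poly p x \<in> F"
  by (auto simp: poly_altdef polys_over_def intro!: sum_mem mult_mem power_mem)

lemma polys_over_const: "[:c:] \<in> polys_over F \<longleftrightarrow> c \<in> F"
  by (auto simp: polys_over_def coeff_pCons split: nat.splits)

lemma polys_over_pCons: "c \<in> F \<Longrightarrow> p \<in> polys_over F \<Longrightarrow> pCons c p \<in> polys_over F"
  by (auto simp: polys_over_def coeff_pCons split: nat.splits)

lemma polys_over_0 [simp]: "0 \<in> polys_over F"
  by (auto simp: polys_over_def)

lemma polys_over_1 [simp]: "1 \<in> polys_over F"
  using polys_over_const[of 1] by (simp add: one_pCons)

lemma polys_over_linear: "c \<in> F \<Longrightarrow> [:- c, 1:] \<in> polys_over F" "c \<in> F \<Longrightarrow> [:c, 1:] \<in> polys_over F"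
  by (auto intro!: polys_over_pCons uminus_mem)

lemma polys_over_add: "p \<in> polys_over F \<Longrightarrow> q \<in> polys_over F \<Longrightarrow> p + q \<in> polys_over F"
  by (auto simp: polys_over_def intro: add_mem)

lemma polys_over_uminus: "p \<in> polys_over F \<Longrightarrow> - p \<in> polys_over F"
  by (auto simp: polys_over_def intro: uminus_mem)

lemma polys_over_diff: "p \<in> polys_over F \<Longrightarrow> q \<in> polys_over F \<Longrightarrow> p - q \<in> polys_over F"
  by (auto simp: polys_over_def intro: diff_mem)

lemma polys_over_smult: "c \<in> F \<Longrightarrow> p \<in> polys_over F \<Longrightarrow> Polynomial.smult c p \<in> polys_over F"
  by (auto simp: polys_over_def intro: mult_mem)

lemma polys_over_mult: "p \<in> polys_over F \<Longrightarrow> q \<in> polys_over F \<Longrightarrow> p * q \<in> polys_over F"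
  by (auto simp: polys_over_def coeff_mult intro!: sum_mem mult_mem)

lemma polys_over_power: "p \<in> polys_over F \<Longrightarrow> p ^ n \<in> polys_over F"
  by (induction n) (auto intro: polys_over_mult)

lemma polys_over_sum: "(\<And>i. i \<in> A \<Longrightarrow> f i \<in> polys_over F) \<Longrightarrow> sum f A \<in> polys_over F"
  by (induction A rule: infinite_finite_induct) (auto intro: polys_over_add)

lemma polys_over_monom: "c \<in> F \<Longrightarrow> Polynomial.monom c n \<in> polys_over F"
  by (auto simp: polys_over_def)

lemma coeff_mem: "p \<in> polys_over F \<Longrightarrow> Polynomial.coeff p i \<in> F"
  by (auto simp: polys_over_def)

lemma polys_over_pcompose: "p \<in> polys_over F \<Longrightarrow> q \<in> polys_over F \<Longrightarrow> pcompose p q \<in> polys_over F"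
proof (induction p)
  case (pCons a p)
  have "Polynomial.coeff (pCons a p) 0 \<in> F" "\<And>i. Polynomial.coeff (pCons a p) (Suc i) \<in> F"
    using pCons.prems(1) by (blast intro: coeff_mem)+
  then have "a \<in> F" "p \<in> polys_over F"
    by (auto simp: polys_over_def)
  with pCons show ?case
    by (auto simp: pcompose_pCons intro!: polys_over_add polys_over_mult polys_over_pCons)
qed auto

text \<open>Q is monic, so cancelling the leading term of f by a monomial multiple of Q divides by
  no coefficient and stays over F. The degree clause lets \<open>expansion_mem\<close> recurse on
  the quotient; the clause \<open>q = 0\<close> covers the case that one cancellation already falls
  below the degree of Q.\<close>

lemma division_mem:
  assumes Q: "Q \<in> polys_over F" "Polynomial.lead_coeff Q = 1" "Polynomial.degree Q > 0"
  shows "f \<in> polys_over F \<Longrightarrow>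
    \<exists>q\<in>polys_over F. \<exists>r\<in>polys_over F. f = q * Q + r \<and> Polynomial.degree r < Polynomial.degree Q
      \<and> (Polynomial.degree Q \<le> Polynomial.degree f \<longrightarrow> Polynomial.degree q < Polynomial.degree f)
      \<and> (Polynomial.degree f < Polynomial.degree Q \<longrightarrow> q = 0)"
proof (induction "Polynomial.degree f" arbitrary: f rule: less_induct)
  case less
  show ?case
  proof (cases "Polynomial.degree f < Polynomial.degree Q")
    case True
    with less.prems show ?thesis
      by (intro bexI[of _ 0] bexI[of _ f]) auto
  next
    case False
    define k where "k = Polynomial.degree f - Polynomial.degree Q"
    define m where "m = Polynomial.monom (Polynomial.lead_coeff f) k"
    have f0: "f \<noteq> 0" and Q0: "Q \<noteq> 0"
      using False Q by auto
    have m: "m \<in> polys_over F"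
      unfolding m_def using less.prems by (intro polys_over_monom coeff_mem)
    have mQ: "Polynomial.degree (m * Q) = Polynomial.degree f" "m \<noteq> 0"
      "Polynomial.lead_coeff (m * Q) = Polynomial.lead_coeff f" "Polynomial.degree m = k"
    proof -
      show "m \<noteq> 0" and k: "Polynomial.degree m = k"
        using f0 by (simp_all add: m_def degree_monom_eq monom_eq_0_iff)
      then show "Polynomial.degree (m * Q) = Polynomial.degree f"
        using Q0 False by (simp add: degree_mult_eq k_def)
      have "Polynomial.lead_coeff m = Polynomial.lead_coeff f"
        unfolding k by (simp add: m_def)
      then show "Polynomial.lead_coeff (m * Q) = Polynomial.lead_coeff f"
        unfolding lead_coeff_mult Q(2) by simp
    qed
    have lt: "Polynomial.degree (f - m * Q) < Polynomial.degree f"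
    proof (rule degree_lessI)
      show "f - m * Q \<noteq> 0 \<or> 0 < Polynomial.degree f"
        using False Q by auto
      show "\<forall>k\<ge>Polynomial.degree f. Polynomial.coeff (f - m * Q) k = 0"
      proof (intro allI impI)
        fix j assume "Polynomial.degree f \<le> j"
        then consider "j = Polynomial.degree f" | "j > Polynomial.degree f"
          by linarith
        then show "Polynomial.coeff (f - m * Q) j = 0"
          using mQ by cases (auto simp: coeff_eq_0)
      qed
    qed
    have "f - m * Q \<in> polys_over F"
      using m less.prems Q by (auto intro!: polys_over_diff polys_over_mult)
    from less.hyps[OF lt this] obtain q r where qr: "q \<in> polys_over F" "r \<in> polys_over F"
      "f - m * Q = q * Q + r" "Polynomial.degree r < Polynomial.degree Q"
      "Polynomial.degree Q \<le> Polynomial.degree (f - m * Q) \<longrightarrow> Polynomial.degree q < Polynomial.degree (f - m * Q)"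
      "Polynomial.degree (f - m * Q) < Polynomial.degree Q \<longrightarrow> q = 0"
      by blast
    have "Polynomial.degree q < Polynomial.degree f"
      using qr(5,6) lt False Q by (cases "Polynomial.degree (f - m * Q) < Polynomial.degree Q") auto
    moreover have "k < Polynomial.degree f"
      using False Q by (auto simp: k_def)
    ultimately have "Polynomial.degree (m + q) < Polynomial.degree f"
      using mQ by (intro degree_add_less) auto
    moreover have "f = (m + q) * Q + r"
      using qr(3) by (simp add: algebra_simps)
    moreover have "m + q \<in> polys_over F"
      using m qr(1) by (rule polys_over_add)
    ultimately show ?thesis
      using qr(2,4) False by blast
  qed
qed

lemma expansion_mem:
  assumes Q: "Q \<in> polys_over F" "Polynomial.lead_coeff Q = 1" "Polynomial.degree Q > 0"
  shows "f \<in> polys_over F \<Longrightarrow>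
    \<exists>n fs. (\<forall>i\<le>n. fs i \<in> polys_over F \<and> Polynomial.degree (fs i) < Polynomial.degree Q) \<and>
      f = (\<Sum>i\<le>n. fs i * Q ^ i)"
proof (induction "Polynomial.degree f" arbitrary: f rule: less_induct)
  case less
  obtain q r where qr: "q \<in> polys_over F" "r \<in> polys_over F" "f = q * Q + r"
      "Polynomial.degree r < Polynomial.degree Q"
      "Polynomial.degree Q \<le> Polynomial.degree f \<longrightarrow> Polynomial.degree q < Polynomial.degree f"
      "Polynomial.degree f < Polynomial.degree Q \<longrightarrow> q = 0"
    using division_mem[OF Q less.prems] by blast
  show ?case
  proof (cases "Polynomial.degree f < Polynomial.degree Q")
    case True
    with less.prems show ?thesis
      by (intro exI[of _ 0] exI[of _ "\<lambda>_. f"]) auto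
  next
    case False
    then obtain n fs where fs: "\<forall>i\<le>n. fs i \<in> polys_over F \<and> Polynomial.degree (fs i) < Polynomial.degree Q"
      "q = (\<Sum>i\<le>n. fs i * Q ^ i)"
      using less.hyps[of q] qr by auto
    define gs where "gs i = (case i of 0 \<Rightarrow> r | Suc j \<Rightarrow> fs j)" for i
    have "f = (\<Sum>i\<le>Suc n. gs i * Q ^ i)"
      unfolding sum.atMost_Suc_shift by (simp add: gs_def qr(3) fs(2) sum_distrib_left algebra_simps)
    moreover have "\<forall>i\<le>Suc n. gs i \<in> polys_over F \<and> Polynomial.degree (gs i) < Polynomial.degree Q"
      using fs(1) qr by (auto simp: gs_def split: nat.splits)
    ultimately show ?thesis by blast
  qed
qed

end

section \<open>Algebraic elements and relative algebraic closures\<close>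

lemma field_set_iff_subfield:
  "field_set F \<longleftrightarrow> subfield F (ring_of_type_algebra :: 'a::field ring)"
proof
  interpret type_algebra: field "ring_of_type_algebra :: 'a ring"
    by (rule field_from_type_algebra)
  assume "field_set F"
  then interpret field_set F .
  show "subfield F ring_of_type_algebra"
    by (intro type_algebra.subfieldI' type_algebra.subringI)
       (auto simp: type_algebra_simps type_algebra_a_inv type_algebra_m_inv
             intro: uminus_mem add_mem mult_mem inverse_mem)
next
  interpret type_algebra: field "ring_of_type_algebra :: 'a ring"
    by (rule field_from_type_algebra)
  assume F: "subfield F (ring_of_type_algebra :: 'a ring)"
  note sub = subringE[OF subfieldE(1)[OF F]]
  show "field_set F"
  proof
    show "0 \<in> F" "1 \<in> F"
      using sub(2,3) by (simp_all add: type_algebra_simps)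
  next
    fix x y assume "x \<in> F" "y \<in> F"
    then show "x + y \<in> F" "x * y \<in> F"
      using sub(6)[of x y] sub(7)[of x y] by (simp_all add: type_algebra_simps)
  next
    fix x assume x: "x \<in> F"
    then show "- x \<in> F"
      using sub(5)[of x] by (simp add: type_algebra_a_inv)
    show "inverse x \<in> F"
      using type_algebra.subfield_m_inv(1)[OF F, of x] x
      by (cases "x = 0") (auto simp: type_algebra_m_inv type_algebra_simps)
  qed
qed

lemma polys_over_mono: "F \<subseteq> E \<Longrightarrow> polys_over F \<subseteq> polys_over E"
  by (auto simp: polys_over_def)

lemma alg_cl_mono: "F \<subseteq> E \<Longrightarrow> alg_cl F \<subseteq> alg_cl E"
  unfolding alg_cl_def using polys_over_mono by blast

text \<open>Polynomials of HOL-Algebra are coefficient lists that begin with the leading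
  coefficient, whereas \<open>Poly\<close> expects the constant one first; hence
  \<open>rev\<close>.\<close>

lemma type_algebra_eval:
  "ring.eval ring_of_type_algebra q x = poly (Poly (rev q)) (x :: 'a::field)"
  by (induction q)
     (auto simp: ring.eval.simps[OF ring_from_type_algebra] type_algebra_simps type_algebra_pow
        Poly_append poly_monom algebra_simps)

text \<open>Gives access to the theory of finite extensions, from which closure under the field
  operations and transitivity of algebraicity are taken.\<close>

lemma mem_alg_cl_iff:
  assumes "field_set (F :: 'a::field set)"
  shows "x \<in> alg_cl F \<longleftrightarrow> ring.algebraic ring_of_type_algebra F x"
proof -
  interpret type_algebra: field "ring_of_type_algebra :: 'a ring"
    by (rule field_from_type_algebra)
  interpret field_set F by fact
  have F: "subfield F (ring_of_type_algebra :: 'a ring)"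
    using assms field_set_iff_subfield by blast
  show ?thesis
  proof
    assume "x \<in> alg_cl F"
    then obtain p where p: "p \<in> polys_over F" "p \<noteq> 0" "poly p x = 0"
      by (auto simp: alg_cl_def)
    define q where "q = rev (Polynomial.coeffs p)"
    have "q \<noteq> []" "type_algebra.eval q x = 0"
      using p by (auto simp: q_def type_algebra_eval)
    moreover have "q \<in> carrier (F [X]\<^bsub>ring_of_type_algebra\<^esub>)"
      using p by (auto simp: univ_poly_def polynomial_def q_def hd_rev last_coeffs_eq_coeff_degree
          type_algebra_simps polys_over_def coeffs_def)
    ultimately show "type_algebra.algebraic F x"
      using type_algebra.algebraicI[of q F x] by (auto simp: type_algebra_simps over_def)
  next
    assume "type_algebra.algebraic F x"
    then obtain q where q: "q \<in> carrier (F [X]\<^bsub>ring_of_type_algebra\<^esub>)" "q \<noteq> []"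
        "ring.eval ring_of_type_algebra q x = \<zero>\<^bsub>ring_of_type_algebra\<^esub>"
      using type_algebra.algebraicE[OF subfieldE(1)[OF F], of x] by (auto simp: type_algebra_simps over_def)
    define p where "p = Poly (rev q)"
    have "set q \<subseteq> F" "hd q \<noteq> 0"
      using q by (auto simp: univ_poly_def polynomial_def type_algebra_simps)
    have "poly p x = 0"
      using q by (simp add: p_def type_algebra_eval type_algebra_simps)
    moreover have "p \<noteq> 0"
    proof
      assume "p = 0"
      then have "nth_default 0 (rev q) (length q - 1) = 0"
        by (metis coeff_0 coeff_Poly_eq p_def)
      then show False
        using \<open>q \<noteq> []\<close> \<open>hd q \<noteq> 0\<close> by (auto simp: nth_default_def rev_nth hd_conv_nth)
    qed
    moreover have "p \<in> polys_over F"
      using \<open>set q \<subseteq> F\<close> nth_mem[of _ "rev q"]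
      by (auto simp: polys_over_def p_def coeff_Poly_eq nth_default_def)
    ultimately show "x \<in> alg_cl F"
      by (auto simp: alg_cl_def)
  qed
qed

text \<open>The ambient type is algebraically closed, so a subfield that contains all roots of its
  own polynomials is itself algebraically closed.\<close>

locale alg_closed_set = field_set F for F :: "'a::alg_closed_field set" +
  assumes root_mem: "p \<in> polys_over F \<Longrightarrow> p \<noteq> 0 \<Longrightarrow> poly p x = 0 \<Longrightarrow> x \<in> F"

lemma (in field_set) subset_alg_cl: "F \<subseteq> alg_cl F"
proof
  fix x assume "x \<in> F"
  then show "x \<in> alg_cl F"
    unfolding alg_cl_def using polys_over_linear(1)[of x] by (intro CollectI bexI[of _ "[:-x, 1:]"]) auto
qed

text \<open>The coefficients of p generate a finite extension A of F, and x is algebraic over A. By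
  the tower law A(x) is finite over F, so x is algebraic over F.\<close>

lemma alg_closed_alg_cl:
  assumes "field_set (F :: 'a::alg_closed_field set)"
  shows "alg_closed_set (alg_cl F)"
proof -
  interpret field_set F by fact
  let ?R = "ring_of_type_algebra :: 'a ring"
  interpret type_algebra: field ?R
    by (rule field_from_type_algebra)
  have F: "subfield F ?R"
    using assms field_set_iff_subfield by blast
  have eq: "alg_cl F = {x \<in> carrier ?R. type_algebra.algebraic F x}"
    using mem_alg_cl_iff[OF assms] by (auto simp: type_algebra_simps)
  have "subfield (alg_cl F) ?R"
    unfolding eq using type_algebra.subfield_of_algebraics[OF F] by (simp add: over_def)
  then interpret cl: field_set "alg_cl F"
    using field_set_iff_subfield by blast
  show ?thesis
  proof
    fix p x assume p: "p \<in> polys_over (alg_cl F)" "p \<noteq> 0" "poly p x = 0"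
    define A where "A = type_algebra.finite_extension F (Polynomial.coeffs p)"
    have alg: "(type_algebra.algebraic over F) y" if "y \<in> set (Polynomial.coeffs p)" for y
      using that p(1) mem_alg_cl_iff[OF assms] by (auto simp: over_def polys_over_def coeffs_def split: if_splits)
    have carr: "set xs \<subseteq> carrier ?R" for xs
      by (simp add: type_algebra_simps)
    have A: "subfield A ?R"
      unfolding A_def by (rule type_algebra.finite_extension_is_subfield[OF F carr alg])
    have dimA: "type_algebra.finite_dimension F A"
      unfolding A_def by (rule type_algebra.finite_extension_finite_dimension(1)[OF F carr alg])
    have A': "field_set A"
      using A field_set_iff_subfield by blast
    interpret fA: field_set A by fact
    have "set (Polynomial.coeffs p) \<subseteq> A"
      unfolding A_def by (rule type_algebra.finite_extension_mem[OF subfieldE(1)[OF F] carr])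
    then have "insert 0 (set (Polynomial.coeffs p)) \<subseteq> A"
      using fA.zero_mem by simp
    then have "range (Polynomial.coeff p) \<subseteq> A"
      unfolding range_coeff .
    then have "p \<in> polys_over A"
      unfolding polys_over_def by blast
    then have "x \<in> alg_cl A"
      using p by (auto simp: alg_cl_def)
    then have xalg: "(type_algebra.algebraic over A) x"
      using mem_alg_cl_iff[OF A'] by (simp add: over_def)
    define B where "B = type_algebra.simple_extension A x"
    have x: "x \<in> carrier ?R"
      by (simp add: type_algebra_simps)
    have "type_algebra.finite_dimension A B"
      unfolding B_def using type_algebra.finite_dimension_simple_extension[OF A x] xalg by blast
    then have "type_algebra.finite_dimension F B"
      by (rule type_algebra.telescopic_base_dim(1)[OF F A dimA])
    moreover have "subring B ?R"
      unfolding B_def by (rule type_algebra.simple_extension_is_subring[OF subfieldE(1)[OF A] x])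
    moreover have "x \<in> B"
      unfolding B_def by (rule type_algebra.simple_extension_mem[OF subfieldE(1)[OF A] x])
    ultimately have "(type_algebra.algebraic over F) x"
      using type_algebra.finite_dimension_imp_algebraic[OF F] by blast
    then show "x \<in> alg_cl F"
      using mem_alg_cl_iff[OF assms] by (simp add: over_def)
  qed
qed

text \<open>Splits off one root at a time while the cofactor stays over F. Statements about
  valuations of polynomials are reduced to linear factors through this rule.\<close>

lemma (in alg_closed_set) factor_induct [consumes 2, case_names const factor]:
  fixes p :: "'a poly"
  assumes "p \<in> polys_over F" "p \<noteq> 0"
    and const: "\<And>c. c \<in> F \<Longrightarrow> c \<noteq> 0 \<Longrightarrow> P [:c:]"
    and factor: "\<And>b q. b \<in> F \<Longrightarrow> q \<in> polys_over F \<Longrightarrow> q \<noteq> 0 \<Longrightarrow> P q \<Longrightarrow> P ([:-b, 1:] * q)"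
  shows "P p"
  using assms(1,2)
proof (induction "Polynomial.degree p" arbitrary: p rule: less_induct)
  case less
  show ?case
  proof (cases "Polynomial.degree p = 0")
    case True
    then obtain c where "p = [:c:]"
      by (rule degree_eq_zeroE)
    with less.prems show ?thesis
      using const[of c] polys_over_const[of c] by auto
  next
    case False
    then obtain b where b: "poly p b = 0"
      using alg_closed_imp_poly_has_root[of p] by blast
    with less.prems have bF: "b \<in> F"
      using root_mem by blast
    obtain q r where qr: "q \<in> polys_over F" "r \<in> polys_over F" "p = q * [:-b, 1:] + r"
        "Polynomial.degree r < Polynomial.degree [:-b, 1:]"
      using division_mem[of "[:-b, 1:]" p] bF less.prems polys_over_linear by auto
    then obtain c where "r = [:c:]"
      by (auto elim: degree_eq_zeroE)
    with qr b have "r = 0"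
      by simp
    with qr have p: "p = [:-b, 1:] * q"
      by (simp add: mult.commute)
    have q0: "q \<noteq> 0"
      using less.prems p by auto
    then have "Polynomial.degree q < Polynomial.degree p"
      unfolding p by (subst degree_mult_eq) auto
    then have "P q"
      using qr(1) q0 by (rule less.hyps)
    with bF qr(1) q0 show ?thesis
      unfolding p by (rule factor)
  qed
qed

section \<open>Gauss valuations\<close>

lemma nsmul_0 [simp]: "nsmul 0 x = 0"
  by (simp add: nsmul_def)

lemma nsmul_Suc [simp]: "nsmul (Suc n) x = nsmul n x + x"
  by (simp add: nsmul_def)

lemma nsmul_add: "nsmul (m + n) x = nsmul m x + nsmul n x"
  by (induction n) (auto simp: ac_simps)

lemma nsmul_Fin [simp]: "nsmul n (Fin x) = Fin (nsmul n x)"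
  by (induction n) (auto simp: zero_extended_def)

lemma extended_add_eq_Minf:
  fixes x y :: "'g::linordered_ab_group_add extended"
  shows "x \<noteq> -\<infinity> \<Longrightarrow> y \<noteq> -\<infinity> \<Longrightarrow> x + y \<noteq> -\<infinity>"
  by (cases x; cases y) auto

lemma extended_add_strict:
  fixes x y z t :: "'g::linordered_ab_group_add extended"
  assumes "x < y" "z \<le> t" "z \<noteq> \<infinity>" "z \<noteq> -\<infinity>" "x \<noteq> -\<infinity>"
  shows "x + z < y + t" "z + x < t + y"
proof -
  show "x + z < y + t"
    using assms by (cases x; cases y; cases z; cases t) (auto intro: add_less_le_mono)
  then show "z + x < t + y"
    by (simp add: add.commute)
qed

text \<open>A subring of a domain rather than a field, so that constants, polynomials under a Gauss
  valuation and rational functions share the same ultrametric lemmas.\<close>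

locale valued_ring =
  fixes S :: "'a::idom set" and v :: "'a \<Rightarrow> 'g::linordered_ab_group_add extended"
  assumes S_zero: "0 \<in> S" and S_one: "1 \<in> S"
    and S_add: "x \<in> S \<Longrightarrow> y \<in> S \<Longrightarrow> x + y \<in> S"
    and S_uminus: "x \<in> S \<Longrightarrow> - x \<in> S"
    and S_mult: "x \<in> S \<Longrightarrow> y \<in> S \<Longrightarrow> x * y \<in> S"
    and v_neq_Minf: "x \<in> S \<Longrightarrow> v x \<noteq> -\<infinity>"
    and v_eq_Pinf_iff: "x \<in> S \<Longrightarrow> v x = \<infinity> \<longleftrightarrow> x = 0"
    and v_mult: "x \<in> S \<Longrightarrow> y \<in> S \<Longrightarrow> v (x * y) = v x + v y"
    and v_add: "x \<in> S \<Longrightarrow> y \<in> S \<Longrightarrow> min (v x) (v y) \<le> v (x + y)"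
begin

lemma S_diff: "x \<in> S \<Longrightarrow> y \<in> S \<Longrightarrow> x - y \<in> S"
  using S_add[of x "- y"] S_uminus[of y] by simp

lemma S_power: "x \<in> S \<Longrightarrow> x ^ n \<in> S"
  by (induction n) (auto intro: S_mult S_one)

lemma S_sum: "(\<And>i. i \<in> A \<Longrightarrow> f i \<in> S) \<Longrightarrow> sum f A \<in> S"
  by (induction A rule: infinite_finite_induct) (auto intro: S_add S_zero)

lemma v_zero [simp]: "v 0 = \<infinity>"
  using v_eq_Pinf_iff S_zero by blast

lemma v_finite: "x \<in> S \<Longrightarrow> x \<noteq> 0 \<Longrightarrow> \<exists>g. v x = Fin g"
  using v_neq_Minf[of x] v_eq_Pinf_iff[of x] by (cases "v x") auto

lemma v_one [simp]: "v 1 = 0"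
proof -
  obtain g where "v 1 = Fin g"
    using v_finite[OF S_one] by auto
  then show ?thesis
    using v_mult[OF S_one S_one] by (simp add: zero_extended_def)
qed

lemma v_uminus [simp]: "x \<in> S \<Longrightarrow> v (- x) = v x"
proof -
  assume x: "x \<in> S"
  have m1: "- 1 \<in> S"
    using S_uminus S_one by blast
  obtain g where g: "v (- 1) = Fin g"
    using v_finite[OF m1] by auto
  have "v ((- 1) * (- 1)) = v (- 1) + v (- 1)"
    by (rule v_mult[OF m1 m1])
  \<comment> \<open>An ordered group has no 2-torsion, so the value of -1 is 0.\<close>
  then have "g + g = 0"
    unfolding g by (simp add: zero_extended_def)
  then have "g = 0"
    by simp
  then show ?thesis
    using v_mult[OF m1 x] g by (simp add: zero_extended_def[symmetric])
qed

lemma v_diff: "x \<in> S \<Longrightarrow> y \<in> S \<Longrightarrow> min (v x) (v y) \<le> v (x - y)"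
  using v_add[of x "- y"] S_uminus[of y] by simp

lemma v_diff_commute: "x \<in> S \<Longrightarrow> y \<in> S \<Longrightarrow> v (x - y) = v (y - x)"
  using v_uminus[of "x - y"] S_diff[of x y] by simp

lemma v_add_eq:
  assumes "x \<in> S" "y \<in> S" "v x < v y"
  shows "v (x + y) = v x" "v (y + x) = v x"
proof -
  have "v x \<le> v (x + y)"
    using v_add[OF assms(1,2)] assms(3) by simp
  moreover have "min (v (x + y)) (v y) \<le> v x"
    using v_diff[of "x + y" y] assms S_add by simp
  ultimately show "v (x + y) = v x"
    using assms(3) by (auto simp: min_def split: if_splits)
  then show "v (y + x) = v x"
    by (simp add: add.commute)
qed

lemma v_diff_eq:
  assumes "x \<in> S" "y \<in> S" "v x < v (x - y)"
  shows "v y = v x"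
  using v_add_eq(1)[of x "y - x"] assms v_diff_commute[of x y] by (auto simp: S_diff)

lemma v_sum_ge:
  assumes "\<And>i. i \<in> A \<Longrightarrow> f i \<in> S \<and> m \<le> v (f i)"
  shows "m \<le> v (sum f A)"
  using assms
proof (induction A rule: infinite_finite_induct)
  case (insert i A)
  then have "m \<le> min (v (f i)) (v (sum f A))" "sum f A \<in> S" "f i \<in> S"
    using S_sum[of A f] by auto
  then have "m \<le> v (f i + sum f A)"
    using v_add[of "f i" "sum f A"] by (meson order_trans)
  with insert.hyps show ?case
    by simp
qed auto

text \<open>The bound has to be finite because the empty sum has value \<infinity>.\<close>

lemma v_sum_gt:
  assumes "\<And>i. i \<in> A \<Longrightarrow> f i \<in> S \<and> m < v (f i)" "m < \<infinity>"
  shows "m < v (sum f A)"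
  using assms(1)
proof (induction A rule: infinite_finite_induct)
  case (insert i A)
  then have "m < min (v (f i)) (v (sum f A))" "sum f A \<in> S" "f i \<in> S"
    using S_sum[of A f] by auto
  then have "m < v (f i + sum f A)"
    using v_add[of "f i" "sum f A"] by (meson order_less_le_trans)
  with insert.hyps show ?case
    by simp
qed (use assms(2) in auto)

lemma v_power: "x \<in> S \<Longrightarrow> v (x ^ n) = nsmul n (v x)"
  by (induction n) (auto simp: v_mult S_power add.commute)

lemma v_mult_strict:
  assumes "x \<in> S" "y \<in> S" "z \<in> S" "z \<noteq> 0" "v x < v y"
  shows "v (x * z) < v (y * z)" "v (z * x) < v (z * y)"
  using extended_add_strict[of "v x" "v y" "v z" "v z"] assms v_neq_Minf v_eq_Pinf_iff
  by (auto simp: v_mult)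

end

lemma (in valued_ring) valued_subring:
  assumes "0 \<in> T" "1 \<in> T" "\<And>x y. x \<in> T \<Longrightarrow> y \<in> T \<Longrightarrow> x + y \<in> T"
    "\<And>x. x \<in> T \<Longrightarrow> - x \<in> T" "\<And>x y. x \<in> T \<Longrightarrow> y \<in> T \<Longrightarrow> x * y \<in> T" "T \<subseteq> S"
  shows "valued_ring T v"
  using assms by (intro valued_ring.intro v_neq_Minf v_eq_Pinf_iff v_mult v_add) (auto dest: subsetD)

section \<open>Gauss valuations on polynomials over a valued field\<close>

locale valued_field = field_set F + valued_ring F w
  for F :: "'a::field set" and w :: "'a \<Rightarrow> 'g::linordered_ab_group_add extended"
begin

text \<open>Admits every index: beyond the degree the coefficient is 0 and the term is \<infinity>,
  so minima can be compared without reference to degrees.\<close>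

definition gauss_term :: "'a \<Rightarrow> 'g \<Rightarrow> 'a poly \<Rightarrow> nat \<Rightarrow> 'g extended" where
  "gauss_term a \<gamma> p i = w (Polynomial.coeff (pcompose p [:a, 1:]) i) + Fin (nsmul i \<gamma>)"

lemma pcompose_shift_mem: "a \<in> F \<Longrightarrow> p \<in> polys_over F \<Longrightarrow> pcompose p [:a, 1:] \<in> polys_over F"
  by (auto intro!: polys_over_pcompose polys_over_linear)

lemma degree_pcompose_shift [simp]:
  "Polynomial.degree (pcompose p [:a, 1 :: 'a:]) = Polynomial.degree p"
  by (simp add: degree_pcompose)

lemma pcompose_shift_eq_0_iff: "pcompose p [:a, 1 :: 'a:] = 0 \<longleftrightarrow> p = 0"
  using pcompose_eq_0[of p "[:a, 1:]"] by auto

lemma gauss_poly_le: "gauss_poly w a \<gamma> p \<le> gauss_term a \<gamma> p i"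
proof (cases "i \<le> Polynomial.degree p")
  case True
  then show ?thesis
    by (auto simp: gauss_poly_def gauss_term_def intro!: Min_le)
next
  case False
  then have "Polynomial.coeff (pcompose p [:a, 1:]) i = 0"
    by (intro coeff_eq_0) auto
  then show ?thesis
    by (simp add: gauss_term_def)
qed

lemma gauss_poly_attained: "\<exists>i. gauss_poly w a \<gamma> p = gauss_term a \<gamma> p i"
proof -
  have "gauss_poly w a \<gamma> p \<in> gauss_term a \<gamma> p ` {..Polynomial.degree p}"
    unfolding gauss_poly_def gauss_term_def by (rule Min_in) auto
  then show ?thesis by auto
qed

lemma gauss_poly_ge: "(\<And>i. m \<le> gauss_term a \<gamma> p i) \<Longrightarrow> m \<le> gauss_poly w a \<gamma> p"
  using gauss_poly_attained[of a \<gamma> p] by auto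

lemma gauss_term_neq_Minf:
  assumes "a \<in> F" "p \<in> polys_over F"
  shows "gauss_term a \<gamma> p i \<noteq> -\<infinity>"
  unfolding gauss_term_def
  using v_neq_Minf[OF coeff_mem[OF pcompose_shift_mem[OF assms]]] by (intro extended_add_eq_Minf) auto

lemma gauss_term_eq_Pinf:
  assumes "a \<in> F" "p \<in> polys_over F"
  shows "gauss_term a \<gamma> p i = \<infinity> \<longleftrightarrow> Polynomial.coeff (pcompose p [:a, 1:]) i = 0"
  using v_eq_Pinf_iff[OF coeff_mem[OF pcompose_shift_mem[OF assms]], of i]
  unfolding gauss_term_def by (cases "w (Polynomial.coeff (pcompose p [:a, 1:]) i)") auto

text \<open>Gauss's lemma. Let i0 and j0 be the least indices at which the two minima are attained.
  In the coefficient of index i0 + j0 of the product, every other pair of indices is smaller in one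
  coordinate and thus contributes a strictly larger value, so nothing cancels the pair (i0,
  j0).\<close>

lemma gauss_poly_mult:
  assumes a: "a \<in> F" and p: "p \<in> polys_over F" and q: "q \<in> polys_over F" and "p \<noteq> 0" "q \<noteq> 0"
  shows "gauss_poly w a \<gamma> (p * q) = gauss_poly w a \<gamma> p + gauss_poly w a \<gamma> q"
proof -
  let ?G = "gauss_poly w a \<gamma>" and ?t = "gauss_term a \<gamma>"
  define P where "P = pcompose p [:a, 1:]"
  define Q where "Q = pcompose q [:a, 1:]"
  have PQ: "P \<in> polys_over F" "Q \<in> polys_over F"
    unfolding P_def Q_def using a p q by (auto intro: pcompose_shift_mem)
  have mem: "Polynomial.coeff P i * Polynomial.coeff Q j \<in> F" for i j
    using PQ by (intro mult_mem coeff_mem)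
  have comp: "pcompose (p * q) [:a, 1:] = P * Q"
    by (simp add: P_def Q_def pcompose_mult)
  have tt: "w (Polynomial.coeff P i * Polynomial.coeff Q j) + Fin (nsmul (i + j) \<gamma>) = ?t p i + ?t q j" for i j
    using PQ by (simp add: v_mult coeff_mem gauss_term_def P_def[symmetric] Q_def[symmetric] nsmul_add
        plus_extended.simps(1)[symmetric] ac_simps del: plus_extended.simps)
  have shift: "m + Fin (- x) \<le> z \<longleftrightarrow> m \<le> z + Fin x" "m + Fin (- x) < z \<longleftrightarrow> m < z + Fin x"
    for m z :: "'g extended" and x
    by (cases m; cases z; auto simp: algebra_simps)+
  have Gp: "?G p \<noteq> -\<infinity>" "?G p \<noteq> \<infinity>" if "p \<in> polys_over F" "p \<noteq> 0" for p
  proof -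
    show "?G p \<noteq> -\<infinity>"
      using gauss_poly_attained[of a \<gamma> p] gauss_term_neq_Minf[OF a that(1), of \<gamma>] by metis
    have "pcompose p [:a, 1:] \<noteq> 0"
      using that pcompose_shift_eq_0_iff[of p a] by simp
    then obtain i where "Polynomial.coeff (pcompose p [:a, 1:]) i \<noteq> 0"
      using leading_coeff_neq_0 by blast
    then have "?t p i \<noteq> \<infinity>"
      using gauss_term_eq_Pinf[OF a that(1)] by blast
    then show "?G p \<noteq> \<infinity>"
      using gauss_poly_le[of a \<gamma> p i] by auto
  qed
  have ge: "?G p + ?G q \<le> ?G (p * q)"
  proof (rule gauss_poly_ge)
    fix k
    have "?G p + ?G q + Fin (- nsmul k \<gamma>) \<le> w (\<Sum>i\<le>k. Polynomial.coeff P i * Polynomial.coeff Q (k - i))"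
    proof (rule v_sum_ge, intro conjI)
      fix i assume i: "i \<in> {..k}"
      have "?G p + ?G q \<le> ?t p i + ?t q (k - i)"
        by (intro add_mono gauss_poly_le)
      then show "?G p + ?G q + Fin (- nsmul k \<gamma>) \<le> w (Polynomial.coeff P i * Polynomial.coeff Q (k - i))"
        using tt[of i "k - i"] i by (simp add: shift)
    qed (rule mem)
    then show "?G p + ?G q \<le> ?t (p * q) k"
      unfolding gauss_term_def comp coeff_mult shift .
  qed
  define i0 where "i0 = (LEAST i. ?G p = ?t p i)"
  define j0 where "j0 = (LEAST j. ?G q = ?t q j)"
  have i0: "?G p = ?t p i0"
    unfolding i0_def using gauss_poly_attained[of a \<gamma> p] by (rule LeastI_ex)
  have j0: "?G q = ?t q j0"
    unfolding j0_def using gauss_poly_attained[of a \<gamma> q] by (rule LeastI_ex)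
  have lt_i0: "?G p < ?t p i" if "i < i0" for i
    using not_less_Least[of i "\<lambda>i. ?G p = ?t p i"] that gauss_poly_le[of a \<gamma> p i]
    unfolding i0_def by auto
  have lt_j0: "?G q < ?t q j" if "j < j0" for j
    using not_less_Least[of j "\<lambda>j. ?G q = ?t q j"] that gauss_poly_le[of a \<gamma> q j]
    unfolding j0_def by auto
  define k where "k = i0 + j0"
  let ?c = "\<lambda>i. Polynomial.coeff P i * Polynomial.coeff Q (k - i)"
  have split: "Polynomial.coeff (P * Q) k = ?c i0 + (\<Sum>i\<in>{..k} - {i0}. ?c i)"
    unfolding coeff_mult by (rule sum.remove) (auto simp: k_def)
  have main: "w (?c i0) + Fin (nsmul k \<gamma>) = ?G p + ?G q"
    using tt[of i0 j0] i0 j0 by (simp add: k_def)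
  then have main': "w (?c i0) = ?G p + ?G q + Fin (- nsmul k \<gamma>)"
    by (cases "w (?c i0)"; cases "?G p"; cases "?G q") (auto simp: algebra_simps)
  have fin: "w (?c i0) < \<infinity>"
    using main' Gp[OF p \<open>p \<noteq> 0\<close>] Gp[OF q \<open>q \<noteq> 0\<close>] by (cases "?G p"; cases "?G q") auto
  have "w (?c i0) < w (\<Sum>i\<in>{..k} - {i0}. ?c i)"
  proof (rule v_sum_gt[OF _ fin], intro conjI)
    fix i assume i: "i \<in> {..k} - {i0}"
    have "?G p + ?G q < ?t p i + ?t q (k - i)"
    proof (cases "i < i0")
      case True
      then show ?thesis
        using lt_i0 gauss_poly_le Gp[OF p \<open>p \<noteq> 0\<close>] Gp[OF q \<open>q \<noteq> 0\<close>] by (intro extended_add_strict) auto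
    next
      case False
      then have "k - i < j0"
        using i by (auto simp: k_def)
      then show ?thesis
        using lt_j0 gauss_poly_le Gp[OF p \<open>p \<noteq> 0\<close>] Gp[OF q \<open>q \<noteq> 0\<close>] by (intro extended_add_strict) auto
    qed
    then show "w (?c i0) < w (?c i)"
      using tt[of i "k - i"] i unfolding main' shift by simp
  qed (rule mem)
  then have "w (Polynomial.coeff (P * Q) k) = w (?c i0)"
    unfolding split by (intro v_add_eq) (auto intro: sum_mem mem)
  then have "?t (p * q) k = ?G p + ?G q"
    unfolding gauss_term_def comp using main by simp
  then show ?thesis
    using gauss_poly_le[of a \<gamma> "p * q" k] ge by simp
qed

lemma gauss_poly_const [simp]: "gauss_poly w a \<gamma> [:c:] = w c"
  by (simp add: gauss_poly_def zero_extended_def[symmetric])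

lemma gauss_poly_0 [simp]: "gauss_poly w a \<gamma> 0 = \<infinity>"
  using gauss_poly_const[of a \<gamma> 0] by simp

lemma gauss_poly_linear: "gauss_poly w a \<gamma> [:- b, 1:] = min (w (a - b)) (Fin \<gamma>)"
proof -
  have "{..Suc 0} = {0, 1}" by auto
  moreover have "x + Fin 0 = x" for x :: "'g extended"
    by (cases x) auto
  ultimately show ?thesis
    by (simp add: gauss_poly_def pcompose_pCons zero_extended_def)
qed

text \<open>The constant term of the expansion in powers of X - a is the value of p at a.\<close>

lemma gauss_poly_le_value: "gauss_poly w a \<gamma> p \<le> w (poly p a)"
  using gauss_poly_le[of a \<gamma> p 0] by (simp add: gauss_term_def coeff_pcompose_0 zero_extended_def[symmetric])

lemma valued_ring_gauss_poly:
  assumes a: "a \<in> F"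
  shows "valued_ring (polys_over F) (gauss_poly w a \<gamma>)"
proof
  fix p q assume p: "p \<in> polys_over F" and q: "q \<in> polys_over F"
  show "gauss_poly w a \<gamma> p \<noteq> -\<infinity>"
    using gauss_poly_attained[of a \<gamma> p] gauss_term_neq_Minf[OF a p, of \<gamma>] by metis
  show "gauss_poly w a \<gamma> p = \<infinity> \<longleftrightarrow> p = 0"
  proof
    assume *: "gauss_poly w a \<gamma> p = \<infinity>"
    have "Polynomial.coeff (pcompose p [:a, 1:]) i = 0" for i
      using gauss_poly_le[of a \<gamma> p i] gauss_term_eq_Pinf[OF a p, of \<gamma> i] unfolding * by simp
    then have "pcompose p [:a, 1:] = 0"
      by (intro poly_eqI) auto
    then show "p = 0"
      by (simp add: pcompose_shift_eq_0_iff)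
  qed simp
  show "gauss_poly w a \<gamma> (p * q) = gauss_poly w a \<gamma> p + gauss_poly w a \<gamma> q"
  proof (cases "p = 0 \<or> q = 0")
    case True
    have inf: "\<infinity> + x = \<infinity>" "x + \<infinity> = \<infinity>" for x :: "'g extended"
      by (cases x; simp)+
    show ?thesis
      using True by (auto simp: inf)
  next
    case False
    then show ?thesis
      using gauss_poly_mult[OF a p q] by blast
  qed
  show "min (gauss_poly w a \<gamma> p) (gauss_poly w a \<gamma> q) \<le> gauss_poly w a \<gamma> (p + q)"
  proof (rule gauss_poly_ge)
    fix i
    let ?x = "Polynomial.coeff (pcompose p [:a, 1:]) i" and ?y = "Polynomial.coeff (pcompose q [:a, 1:]) i"
    have "min (w ?x) (w ?y) \<le> w (?x + ?y)"
      by (intro v_add coeff_mem pcompose_shift_mem a p q)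
    then have "min (gauss_term a \<gamma> p i) (gauss_term a \<gamma> q i) \<le> gauss_term a \<gamma> (p + q) i"
      unfolding gauss_term_def pcompose_add coeff_add
      by (cases "w ?x"; cases "w ?y"; cases "w (?x + ?y)")
         (auto simp: min_def split: if_splits)
    moreover have "min (gauss_poly w a \<gamma> p) (gauss_poly w a \<gamma> q) \<le> min (gauss_term a \<gamma> p i) (gauss_term a \<gamma> q i)"
      using gauss_poly_le[of a \<gamma> p i] gauss_poly_le[of a \<gamma> q i] by (auto simp: min_def)
    ultimately show "min (gauss_poly w a \<gamma> p) (gauss_poly w a \<gamma> q) \<le> gauss_term a \<gamma> (p + q) i"
      by (rule order_trans[rotated])
  qed
qed (auto intro: polys_over_add polys_over_mult polys_over_uminus)

end

section \<open>Truncations\<close>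

lemma pcompose_power: "pcompose (p ^ n) q = pcompose p q ^ n" for p q :: "'a::comm_ring_1 poly"
  by (induction n) (simp_all add: pcompose_mult pcompose_1)

text \<open>Truncations involve values of polynomials only. Abstracting from rational functions lets
  the same theory serve both v over K and the induced valuation over the completion.\<close>

locale poly_valued = alg_closed_set E + valued_ring "polys_over E" V
  for E :: "'c::alg_closed_field set" and V :: "'c poly \<Rightarrow> 'g::linordered_ab_group_add extended"
begin

abbreviation w :: "'c \<Rightarrow> 'g extended" where
  "w c \<equiv> V [:c:]"

sublocale const: valued_field E "\<lambda>c. V [:c:]"
proof
  fix x y assume xy: "x \<in> E" "y \<in> E"
  then have "[:x:] \<in> polys_over E" "[:y:] \<in> polys_over E"
    by (auto simp: polys_over_const)
  then show "V [:x:] \<noteq> -\<infinity>" "V [:x:] = \<infinity> \<longleftrightarrow> x = 0"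
    "V [:x * y:] = V [:x:] + V [:y:]" "min (V [:x:]) (V [:y:]) \<le> V [:x + y:]"
    using v_neq_Minf[of "[:x:]"] v_eq_Pinf_iff[of "[:x:]"] v_mult[of "[:x:]" "[:y:]"]
      v_add[of "[:x:]" "[:y:]"] by (auto simp: mult.commute)
qed (auto intro: add_mem uminus_mem mult_mem)

lemma w_finite: "c \<in> E \<Longrightarrow> c \<noteq> 0 \<Longrightarrow> \<exists>g. w c = Fin g"
  by (rule const.v_finite)

lemma linear_mem [intro]: "b \<in> E \<Longrightarrow> [:- b, 1:] \<in> polys_over E"
  by (rule polys_over_linear)

lemma const_mem [intro]: "b \<in> E \<Longrightarrow> [:b:] \<in> polys_over E"
  by (simp add: polys_over_const)

lemma linear_finite: "b \<in> E \<Longrightarrow> \<exists>g. V [:- b, 1:] = Fin g"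
  by (rule v_finite) auto

text \<open>An ultrametric triangle with sides X - b, X - a and a - b: the first and the last can
  differ in value only when both reach \<gamma>.\<close>

lemma min_V_linear:
  assumes a: "a \<in> E" and b: "b \<in> E" and \<gamma>: "V [:- a, 1:] = Fin \<gamma>"
  shows "min (V [:- b, 1:]) (Fin \<gamma>) = min (w (a - b)) (Fin \<gamma>)"
proof -
  have eq: "[:- b, 1:] = [:- a, 1:] + [:a - b:]"
    by simp
  have mem: "[:- a, 1:] \<in> polys_over E" "[:a - b:] \<in> polys_over E"
    using a b by (auto intro: diff_mem)
  show ?thesis
  proof (cases "w (a - b) < Fin \<gamma>")
    case True
    then have "V [:- b, 1:] = w (a - b)"
      unfolding eq using mem \<gamma> by (intro v_add_eq) auto
    then show ?thesis by simp
  next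
    case False
    have "min (Fin \<gamma>) (w (a - b)) \<le> V [:- b, 1:]"
      unfolding eq using v_add[OF mem] \<gamma> by simp
    with False show ?thesis
      by (auto simp: min_def split: if_splits)
  qed
qed

lemma gauss_linear_eq:
  assumes "a \<in> E" "b \<in> E" "V [:- a, 1:] = Fin \<gamma>"
  shows "gauss_poly w a \<gamma> [:- b, 1:] = min (V [:- b, 1:]) (Fin \<gamma>)"
  using min_V_linear[OF assms] by (simp add: const.gauss_poly_linear)

text \<open>The two claims are proved together because a sum of inequalities is an equality only if
  each summand is one, and this uses the inequality for the cofactor.\<close>

lemma gauss_le_and_eq_iff:
  assumes a: "a \<in> E" and \<gamma>: "V [:- a, 1:] = Fin \<gamma>" and p: "p \<in> polys_over E" "p \<noteq> 0"
  shows "gauss_poly w a \<gamma> p \<le> V p \<and>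
    (gauss_poly w a \<gamma> p = V p \<longleftrightarrow> (\<forall>b. poly p b = 0 \<longrightarrow> V [:- b, 1:] \<le> Fin \<gamma>))"
  using p
proof (induction p rule: factor_induct)
  case (factor b q)
  let ?G = "gauss_poly w a \<gamma>"
  interpret G: valued_ring "polys_over E" ?G
    using a by (rule const.valued_ring_gauss_poly)
  have lin: "[:- b, 1:] \<in> polys_over E"
    using factor by auto
  obtain g where g: "V [:- b, 1:] = Fin g"
    using linear_finite factor by blast
  obtain h where h: "V q = Fin h"
    using v_finite factor by blast
  obtain h' where h': "?G q = Fin h'"
    using G.v_finite factor by blast
  have Vp: "V ([:- b, 1:] * q) = Fin (g + h)"
    using g h v_mult[OF lin factor(2)] by simp
  have Gp: "?G ([:- b, 1:] * q) = Fin (min g \<gamma> + h')"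
    using g h' gauss_linear_eq[OF a factor(1) \<gamma>] G.v_mult[OF lin factor(2)] by simp
  have le: "h' \<le> h"
    using factor.IH h h' by simp
  have "min g \<gamma> + h' = g + h \<longleftrightarrow> g \<le> \<gamma> \<and> h' = h"
  proof
    assume *: "min g \<gamma> + h' = g + h"
    have "\<not> h' < h"
      using add_le_less_mono[of "min g \<gamma>" g h' h] * by auto
    with le have "h' = h" by simp
    with * show "g \<le> \<gamma> \<and> h' = h"
      by (auto simp: min_def split: if_splits)
  qed (auto simp: min_def)
  moreover have "min g \<gamma> + h' \<le> g + h"
    using le by (intro add_mono) auto
  ultimately show ?case
    unfolding Vp Gp using factor.IH g h h' by auto
qed (auto simp: zero_extended_def)

lemma gauss_eq_V_iff:
  assumes "a \<in> E" "V [:- a, 1:] = Fin \<gamma>" "p \<in> polys_over E" "p \<noteq> 0"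
  shows "gauss_poly w a \<gamma> p = V p \<longleftrightarrow> (\<forall>b. poly p b = 0 \<longrightarrow> V [:- b, 1:] \<le> Fin \<gamma>)"
  using gauss_le_and_eq_iff[OF assms] by blast

text \<open>In each factor \<open>X - b = (a - b) + (X - a)\<close> the second summand has the larger value.\<close>

lemma gauss_const_dominates:
  assumes a: "a \<in> E" and \<gamma>: "V [:- a, 1:] = Fin \<gamma>" and p: "p \<in> polys_over E" "p \<noteq> 0"
    and roots: "\<And>b. poly p b = 0 \<Longrightarrow> V [:- b, 1:] < Fin \<gamma>"
  shows "gauss_poly w a \<gamma> p < gauss_poly w a \<gamma> (p - [:poly p a:])"
  using p roots
proof (induction p rule: factor_induct)
  case (const c)
  then show ?case
    using w_finite[of c] by auto
next
  case (factor b q)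
  let ?G = "gauss_poly w a \<gamma>"
  interpret G: valued_ring "polys_over E" ?G
    using a by (rule const.valued_ring_gauss_poly)
  have lt: "V [:- b, 1:] < Fin \<gamma>"
    using factor.prems[of b] by simp
  then have Gb: "?G [:- b, 1:] = w (a - b)" and wlt: "w (a - b) < Fin \<gamma>"
    using gauss_linear_eq[OF a \<open>b \<in> E\<close> \<gamma>] min_V_linear[OF a \<open>b \<in> E\<close> \<gamma>] const.gauss_poly_linear[of a \<gamma> b]
    by (auto simp: min_def split: if_splits)
  have Ga: "?G [:- a, 1:] = Fin \<gamma>"
    using gauss_linear_eq[OF a a \<gamma>] \<gamma> by simp
  have IH: "?G q < ?G (q - [:poly q a:])"
    using factor.IH factor.prems by simp
  have qa: "q - [:poly q a:] \<in> polys_over E"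
    using a factor by (intro polys_over_diff) (auto intro: poly_mem)
  have ab: "[:a - b:] \<in> polys_over E" "a - b \<noteq> 0"
    using a factor wlt by (auto intro: diff_mem)
  \<comment> \<open>The factor X - b is X - a plus its own value a - b at a. The first part
    multiplies all of q, the second only the error of q.\<close>
  have split: "[:- b, 1:] * q - [:poly ([:- b, 1:] * q) a:] = [:- a, 1:] * q + [:a - b:] * (q - [:poly q a:])"
    by (simp add: algebra_simps smult_diff_left)
  have lt1: "?G ([:- b, 1:] * q) < ?G ([:- a, 1:] * q)"
    using a factor wlt Ga Gb by (intro G.v_mult_strict(1)) auto
  have eq: "?G ([:- b, 1:] * q) = ?G ([:a - b:] * q)"
    using factor ab Gb linear_mem[OF \<open>b \<in> E\<close>] by (subst (1 2) G.v_mult) auto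
  have lt2: "?G ([:a - b:] * q) < ?G ([:a - b:] * (q - [:poly q a:]))"
    using factor ab IH qa by (intro G.v_mult_strict(2)) auto
  have "min (?G ([:- a, 1:] * q)) (?G ([:a - b:] * (q - [:poly q a:])))
      \<le> ?G ([:- a, 1:] * q + [:a - b:] * (q - [:poly q a:]))"
    using a factor ab qa by (intro G.v_add polys_over_mult) auto
  moreover have "?G ([:- b, 1:] * q) < min (?G ([:- a, 1:] * q)) (?G ([:a - b:] * (q - [:poly q a:])))"
    unfolding min_less_iff_conj using lt1 lt2 unfolding eq by (rule conjI)
  ultimately show ?case
    unfolding split by (rule order_less_le_trans[rotated])
qed

text \<open>The error p - p(a) has larger value than p. This allows the digits of a Q-adic expansion
  to be replaced by their values at a.\<close>

lemma gauss_eq_value: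
  assumes a: "a \<in> E" and \<gamma>: "V [:- a, 1:] = Fin \<gamma>" and p: "p \<in> polys_over E"
    and roots: "\<And>b. p \<noteq> 0 \<Longrightarrow> poly p b = 0 \<Longrightarrow> V [:- b, 1:] < Fin \<gamma>"
  shows "w (poly p a) = gauss_poly w a \<gamma> p"
proof (cases "p = 0")
  case False
  interpret G: valued_ring "polys_over E" "gauss_poly w a \<gamma>"
    using a by (rule const.valued_ring_gauss_poly)
  have "[:poly p a:] \<in> polys_over E"
    using a p by (auto intro: poly_mem)
  then show ?thesis
    using G.v_diff_eq[OF p, of "[:poly p a:]"] gauss_const_dominates[OF a \<gamma> p False roots] False
    by simp
qed simp

text \<open>If \<open>a\<close> is a root of \<open>Q\<close>, then \<open>-y\<close> is the constant term of \<open>Q - y\<close> as a polynomial in \<open>X - a\<close>.\<close>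

lemma gauss_diff_const:
  assumes a: "a \<in> E" and Q: "Q \<in> polys_over E" "poly Q a = 0" and y: "y \<in> E"
  shows "gauss_poly w a \<gamma> (Q - [:y:]) = min (gauss_poly w a \<gamma> Q) (w y)"
proof -
  let ?G = "gauss_poly w a \<gamma>"
  interpret G: valued_ring "polys_over E" ?G
    using a by (rule const.valued_ring_gauss_poly)
  have ge: "min (?G Q) (w y) \<le> ?G (Q - [:y:])"
    using G.v_diff[OF Q(1), of "[:y:]"] y by auto
  have le: "?G (Q - [:y:]) \<le> w y"
    using const.gauss_poly_le_value[of a \<gamma> "Q - [:y:]"] Q(2) y by simp
  show ?thesis
  proof (cases "?G Q < w y")
    case True
    then have "?G (Q - [:y:]) = ?G Q"
      unfolding diff_conv_add_uminus using Q(1) polys_over_uminus[OF const_mem[OF y]] G.v_uminus[OF const_mem[OF y]]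
      by (intro G.v_add_eq(1)) simp_all
    with True show ?thesis by simp
  qed (use ge le in auto)
qed

text \<open>
  Both sides are multiplicative in \<open>P\<close>, so linear factors suffice. Together with
  \<open>gauss_const_dominates\<close>, which replaces coefficients of small degree by constants, this computes
  \<open>\<omega>\<^sub>a\<close> on \<open>Q\<close>-adic expansions.
\<close>

lemma gauss_pcompose:
  assumes a: "a \<in> E" and Q: "Q \<in> polys_over E" "poly Q a = 0" and \<mu>: "gauss_poly w a \<gamma> Q = Fin \<mu>"
    and P: "P \<in> polys_over E"
  shows "gauss_poly w a \<gamma> (pcompose P Q) = gauss_poly w 0 \<mu> P"
proof (cases "P = 0")
  case False
  interpret G: valued_ring "polys_over E" "gauss_poly w a \<gamma>"
    using a by (rule const.valued_ring_gauss_poly)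
  interpret G0: valued_ring "polys_over E" "gauss_poly w 0 \<mu>"
    by (rule const.valued_ring_gauss_poly) simp
  show ?thesis
    using P False
  proof (induction P rule: factor_induct)
    case (factor b q)
    have "gauss_poly w 0 \<mu> [:- b, 1:] = min (w b) (Fin \<mu>)"
      using const.v_uminus[of b] factor by (simp add: const.gauss_poly_linear)
    moreover have "pcompose ([:- b, 1:] * q) Q = (Q - [:b:]) * pcompose q Q"
      by (simp only: pcompose_mult) (simp add: pcompose_pCons)
    moreover have "gauss_poly w a \<gamma> (Q - [:b:]) = min (Fin \<mu>) (w b)"
      using gauss_diff_const[OF a Q factor(1)] \<mu> by simp
    moreover have "gauss_poly w a \<gamma> ((Q - [:b:]) * pcompose q Q) =
        gauss_poly w a \<gamma> (Q - [:b:]) + gauss_poly w a \<gamma> (pcompose q Q)"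
      using Q factor by (intro G.v_mult polys_over_diff polys_over_pcompose) auto
    moreover have "gauss_poly w 0 \<mu> ([:- b, 1:] * q) = gauss_poly w 0 \<mu> [:- b, 1:] + gauss_poly w 0 \<mu> q"
      using factor by (intro G0.v_mult) auto
    ultimately show ?case
      using factor.IH by (simp add: min.commute)
  qed auto
qed auto

text \<open>The sum is P(Q) for a polynomial P with constant coefficients, so its value is that of P
  under the Gauss valuation with center 0 and radius \<mu>, the value of Q.\<close>

lemma gauss_sum_const_power:
  assumes a: "a \<in> E" and Q: "Q \<in> polys_over E" "poly Q a = 0" and \<mu>: "gauss_poly w a \<gamma> Q = Fin \<mu>"
    and c: "\<And>i. i \<le> n \<Longrightarrow> c i \<in> E"
  shows "gauss_poly w a \<gamma> (\<Sum>i\<le>n. [:c i:] * Q ^ i) = Min ((\<lambda>i. w (c i) + Fin (nsmul i \<mu>)) ` {..n})"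
proof -
  define P where "P = (\<Sum>i\<le>n. Polynomial.monom (c i) i)"
  have P: "P \<in> polys_over E"
    unfolding P_def using c by (intro polys_over_sum polys_over_monom) auto
  have coeff_P: "Polynomial.coeff P i = (if i \<le> n then c i else 0)" for i
    by (auto simp: P_def coeff_sum coeff_monom)
  have "pcompose P Q = (\<Sum>i\<le>n. [:c i:] * Q ^ i)"
    unfolding P_def pcompose_sum
  proof (rule sum.cong)
    fix i
    have "Polynomial.monom (c i) i = [:c i:] * [:0, 1:] ^ i"
      by (simp add: monom_altdef)
    then show "pcompose (Polynomial.monom (c i) i) Q = [:c i:] * Q ^ i"
      by (simp only: pcompose_mult pcompose_const pcompose_power) (simp add: pcompose_pCons)
  qed simp
  then have "gauss_poly w a \<gamma> (\<Sum>i\<le>n. [:c i:] * Q ^ i) = gauss_poly w 0 \<mu> P"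
    using gauss_pcompose[OF a Q \<mu> P] by simp
  also have "\<dots> = Min ((\<lambda>i. w (c i) + Fin (nsmul i \<mu>)) ` {..n})"
  proof -
    \<comment> \<open>The degree of \<open>P\<close> may be smaller than \<open>n\<close>, so the
      two minima run over different ranges; the terms in between are infinite.\<close>
    have term_eq: "const.gauss_term 0 \<mu> P i = (if i \<le> n then w (c i) + Fin (nsmul i \<mu>) else \<infinity>)" for i
      by (simp add: const.gauss_term_def coeff_P)
    show ?thesis
    proof (rule antisym)
      show "gauss_poly w 0 \<mu> P \<le> Min ((\<lambda>i. w (c i) + Fin (nsmul i \<mu>)) ` {..n})"
      proof (intro Min.boundedI)
        fix x assume "x \<in> (\<lambda>i. w (c i) + Fin (nsmul i \<mu>)) ` {..n}"
        then obtain i where "i \<le> n" "x = w (c i) + Fin (nsmul i \<mu>)"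
          by auto
        then show "gauss_poly w 0 \<mu> P \<le> x"
          using const.gauss_poly_le[of 0 \<mu> P i] term_eq[of i] by simp
      qed auto
      show "Min ((\<lambda>i. w (c i) + Fin (nsmul i \<mu>)) ` {..n}) \<le> gauss_poly w 0 \<mu> P"
        by (rule const.gauss_poly_ge) (auto simp: term_eq)
    qed
  qed
  finally show ?thesis .
qed

end

section \<open>Truncations at key polynomials\<close>

locale key_valuation = base: field_set F + poly_valued "alg_cl F" "\<lambda>p. v (to_fract p)"
  for F :: "'c::alg_closed_field set" and v :: "'c poly fract \<Rightarrow> 'g::linordered_ab_group_add extended"
begin

lemma v_0 [simp]: "v 0 = \<infinity>"
  using v_zero by simp

lemma polys_over_alg_cl: "p \<in> polys_over F \<Longrightarrow> p \<in> polys_over (alg_cl F)"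
  using polys_over_mono[OF base.subset_alg_cl] by blast

lemma root_mem_alg_cl: "f \<in> polys_over F \<Longrightarrow> f \<noteq> 0 \<Longrightarrow> poly f b = 0 \<Longrightarrow> b \<in> alg_cl F"
  by (auto simp: alg_cl_def)

text \<open>Roots of a polynomial over F lie in \<open>alg_cl F\<close> automatically, so the
  maximum runs over all roots; these are finitely many, and at least one exists.\<close>

lemma delta_facts:
  assumes f: "f \<in> nonconst_polys F"
  shows "delta F v f \<le> d \<longleftrightarrow> (\<forall>b. poly f b = 0 \<longrightarrow> v (to_fract [:- b, 1:]) \<le> d)"
    and "\<exists>a\<in>alg_cl F. poly f a = 0 \<and> delta F v f = v (to_fract [:- a, 1:])"
    and "\<And>b. poly f b = 0 \<Longrightarrow> v (to_fract [:- b, 1:]) \<le> delta F v f"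
proof -
  have f': "f \<in> polys_over F" "f \<noteq> 0" "Polynomial.degree f > 0"
    using f by (auto simp: nonconst_polys_def)
  have eq: "{v (to_fract [:-a, 1:]) | a. a \<in> alg_cl F \<and> poly f a = 0} =
      (\<lambda>a. v (to_fract [:-a, 1:])) ` {a. poly f a = 0}" (is "?M = ?N")
    using root_mem_alg_cl[OF f'(1,2)] by auto
  have fin: "finite ?N"
    using f'(2) by (intro finite_imageI poly_roots_finite)
  have ne: "?N \<noteq> {}"
    using alg_closed_imp_poly_has_root[OF f'(3)] by auto
  have d: "delta F v f = Max ?N"
    unfolding delta_def eq ..
  show "delta F v f \<le> d \<longleftrightarrow> (\<forall>b. poly f b = 0 \<longrightarrow> v (to_fract [:- b, 1:]) \<le> d)"
    unfolding d using fin ne by (subst Max_le_iff) auto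
  show "\<exists>a\<in>alg_cl F. poly f a = 0 \<and> delta F v f = v (to_fract [:- a, 1:])"
    using Max_in[OF fin ne] root_mem_alg_cl[OF f'(1,2)] unfolding d by auto
  show "\<And>b. poly f b = 0 \<Longrightarrow> v (to_fract [:- b, 1:]) \<le> delta F v f"
    unfolding d using fin by (intro Max_ge) auto
qed

text \<open>Each digit has degree below that of Q, so all its roots b satisfy v (X - b) < \<gamma>,
  and exchanging the digit for its value at a costs only terms of larger value. What remains is a
  polynomial in Q with constant coefficients. The Gauss valuation does not refer to an expansion, so
  all expansions give the same minimum and the \<open>THE\<close> in \<open>truncation\<close> is
  justified.\<close>

lemma truncation_eq_gauss:
  assumes Q: "key_polynomial F v Q"
    and a: "a \<in> alg_cl F" "poly Q a = 0" and \<delta>: "delta F v Q = v (to_fract [:- a, 1:])"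
    and \<gamma>: "v (to_fract [:- a, 1:]) = Fin \<gamma>"
    and f: "f \<in> polys_over F"
  shows "truncation F v Q f = gauss_poly w a \<gamma> f"
proof -
  let ?V = "\<lambda>p. v (to_fract p)" and ?G = "gauss_poly w a \<gamma>"
  interpret G: valued_ring "polys_over (alg_cl F)" ?G
    using a(1) by (rule const.valued_ring_gauss_poly)
  have Q': "Q \<in> nonconst_polys F" "Q \<in> polys_over F" "Polynomial.lead_coeff Q = 1" "Polynomial.degree Q > 0"
    using Q by (auto simp: key_polynomial_def nonconst_polys_def)
  then have Qcl: "Q \<in> polys_over (alg_cl F)" "Q \<noteq> 0"
    by (auto intro: polys_over_alg_cl)
  \<comment> \<open>The root a was chosen with maximal value, so no root of Q exceeds the
    radius.\<close>
  have GQ: "?G Q = ?V Q"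
    using gauss_eq_V_iff[OF a(1) \<gamma> Qcl] delta_facts(3)[OF Q'(1)] \<delta> \<gamma> by auto
  obtain \<mu> where \<mu>: "?G Q = Fin \<mu>"
    using G.v_finite[OF Qcl] by blast
  have VQ: "?V Q = Fin \<mu>"
    using GQ \<mu> by simp
  have small: "?V [:- b, 1:] < Fin \<gamma>"
    if h: "h \<in> polys_over F" "Polynomial.degree h < Polynomial.degree Q" "h \<noteq> 0" "poly h b = 0" for h b
  proof -
    have "Polynomial.degree h > 0"
      using h(3,4) by (cases "Polynomial.degree h = 0") (auto elim: degree_eq_zeroE)
    with h have "h \<in> nonconst_polys F"
      by (simp add: nonconst_polys_def)
    then have "delta F v h < delta F v Q" "?V [:- b, 1:] \<le> delta F v h"
      using Q h(2,4) delta_facts(3)[of h b] unfolding key_polynomial_def by blast+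
    then show ?thesis
      unfolding \<delta> \<gamma> by (rule order_le_less_trans[rotated])
  qed
  have expansion: "?G f = Min ((\<lambda>i. ?V (fs i) + nsmul i (?V Q)) ` {..n})"
    if fs: "\<And>i. i \<le> n \<Longrightarrow> fs i \<in> polys_over F \<and> Polynomial.degree (fs i) < Polynomial.degree Q"
      and f_eq: "f = (\<Sum>i\<le>n. fs i * Q ^ i)" for n fs
  proof -
    define m where "m = Min ((\<lambda>i. ?V (fs i) + nsmul i (?V Q)) ` {..n})"
    have fs_cl: "fs i \<in> polys_over (alg_cl F)" if "i \<le> n" for i
      using fs[OF that] by (blast intro: polys_over_alg_cl)
    have val: "poly (fs i) a \<in> alg_cl F" if "i \<le> n" for i
      using a(1) fs_cl[OF that] by (intro poly_mem)
    have roots: "?V [:- b, 1:] < Fin \<gamma>" if "i \<le> n" "fs i \<noteq> 0" "poly (fs i) b = 0" for i b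
      using small[of "fs i" b] fs[OF that(1)] that(2,3) by blast
    have Gfs: "?G (fs i) = ?V (fs i)" if "i \<le> n" for i
    proof (cases "fs i = 0")
      case False
      show ?thesis
        unfolding gauss_eq_V_iff[OF a(1) \<gamma> fs_cl[OF that] False]
        using roots[OF that False] by (intro allI impI less_imp_le)
    qed simp
    have wfs: "w (poly (fs i) a) = ?V (fs i)" if "i \<le> n" for i
      using gauss_eq_value[OF a(1) \<gamma> fs_cl[OF that] roots[OF that]] Gfs[OF that] by simp
    let ?S = "\<Sum>i\<le>n. [:poly (fs i) a:] * Q ^ i" and ?D = "\<Sum>i\<le>n. (fs i - [:poly (fs i) a:]) * Q ^ i"
    have split: "f = ?S + ?D"
      unfolding f_eq by (simp add: sum.distrib[symmetric] algebra_simps)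
    have "?G ?S = Min ((\<lambda>i. w (poly (fs i) a) + Fin (nsmul i \<mu>)) ` {..n})"
      using a Qcl \<mu> val by (intro gauss_sum_const_power) auto
    also have "\<dots> = m"
      unfolding m_def using wfs VQ by (intro arg_cong[of _ _ Min] image_cong) auto
    finally have GS: "?G ?S = m" .
    \<comment> \<open>Estimating \<open>?D\<close> strictly from below needs a finite bound, and
      \<open>m\<close> is infinite exactly if all digits vanish.\<close>
    show ?thesis
    proof (cases "\<forall>i\<le>n. fs i = 0")
      case True
      then have "f = 0"
        unfolding f_eq by simp
      moreover have "?S = 0"
        using True by simp
      ultimately show ?thesis
        using GS by (simp add: m_def)
    next
      case False
      have m_le: "m \<le> ?V (fs i) + nsmul i (?V Q)" if "i \<le> n" for i
        unfolding m_def using that by (intro Min_le) auto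
      obtain j where j: "j \<le> n" "fs j \<noteq> 0"
        using False by blast
      then have "?V (fs j) + nsmul j (?V Q) < \<infinity>"
        using v_finite[OF fs_cl[OF j(1)] j(2)] VQ by auto
      with m_le[OF j(1)] have m_fin: "m < \<infinity>"
        by simp
      have mem: "(fs i - [:poly (fs i) a:]) \<in> polys_over (alg_cl F)" if "i \<le> n" for i
        using fs_cl[OF that] val[OF that] by (intro polys_over_diff) auto
      have "m < ?G ?D"
      proof (rule G.v_sum_gt[OF _ m_fin], intro conjI)
        fix i assume "i \<in> {..n}"
        then have i: "i \<le> n" by simp
        show "(fs i - [:poly (fs i) a:]) * Q ^ i \<in> polys_over (alg_cl F)"
          using mem[OF i] Qcl by (intro polys_over_mult polys_over_power)
        show "m < ?G ((fs i - [:poly (fs i) a:]) * Q ^ i)"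
        proof (cases "fs i = 0")
          case False
          have "?G (fs i) < ?G (fs i - [:poly (fs i) a:])"
            using roots[OF i False] by (rule gauss_const_dominates[OF a(1) \<gamma> fs_cl[OF i] False])
          then have "?G (fs i * Q ^ i) < ?G ((fs i - [:poly (fs i) a:]) * Q ^ i)"
            using mem[OF i] fs_cl[OF i] Qcl(2) polys_over_power[OF Qcl(1)] by (intro G.v_mult_strict) simp_all
          moreover have "?G (fs i * Q ^ i) = ?V (fs i) + nsmul i (?V Q)"
            using fs_cl[OF i] Qcl Gfs[OF i] GQ by (simp add: G.v_mult G.v_power polys_over_power)
          ultimately show ?thesis
            using m_le[OF i] by simp
        qed (use m_fin in simp)
      qed
      moreover have "?S \<in> polys_over (alg_cl F)" "?D \<in> polys_over (alg_cl F)"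
      proof -
        have "[:poly (fs i) a:] * Q ^ i \<in> polys_over (alg_cl F)" if "i \<le> n" for i
          using const_mem[OF val[OF that]] Qcl(1) by (intro polys_over_mult polys_over_power)
        then show "?S \<in> polys_over (alg_cl F)"
          by (intro polys_over_sum) simp
        have "(fs i - [:poly (fs i) a:]) * Q ^ i \<in> polys_over (alg_cl F)" if "i \<le> n" for i
          using mem[OF that] Qcl(1) by (intro polys_over_mult polys_over_power)
        then show "?D \<in> polys_over (alg_cl F)"
          by (intro polys_over_sum) simp
      qed
      ultimately have "?G (?S + ?D) = ?G ?S"
        unfolding GS[symmetric] by (intro G.v_add_eq)
      then show ?thesis
        using GS split by (simp add: m_def)
    qed
  qed
  show ?thesis
    unfolding truncation_def
  proof (rule the_equality)
    show "\<exists>n fs. (\<forall>i\<le>n. fs i \<in> polys_over F \<and> Polynomial.degree (fs i) < Polynomial.degree Q) \<and>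
        f = (\<Sum>i\<le>n. fs i * Q ^ i) \<and> ?G f = Min ((\<lambda>i. ?V (fs i) + nsmul i (?V Q)) ` {..n})"
    proof -
      obtain n fs where fs: "\<forall>i\<le>n. fs i \<in> polys_over F \<and> Polynomial.degree (fs i) < Polynomial.degree Q"
          "f = (\<Sum>i\<le>n. fs i * Q ^ i)"
        using base.expansion_mem[OF Q'(2-4) f] by blast
      then show ?thesis
        using expansion[of n fs] by (intro exI[of _ n] exI[of _ fs]) simp
    qed
  next
    fix m assume "\<exists>n fs. (\<forall>i\<le>n. fs i \<in> polys_over F \<and> Polynomial.degree (fs i) < Polynomial.degree Q) \<and>
        f = (\<Sum>i\<le>n. fs i * Q ^ i) \<and> m = Min ((\<lambda>i. ?V (fs i) + nsmul i (?V Q)) ` {..n})"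
    then obtain n fs where "\<forall>i\<le>n. fs i \<in> polys_over F \<and> Polynomial.degree (fs i) < Polynomial.degree Q"
        "f = (\<Sum>i\<le>n. fs i * Q ^ i)" "m = Min ((\<lambda>i. ?V (fs i) + nsmul i (?V Q)) ` {..n})"
      by blast
    then show "m = ?G f"
      using expansion[of n fs] by simp
  qed
qed

lemma truncation_eq_iff:
  assumes Q: "key_polynomial F v Q" and f: "f \<in> nonconst_polys F"
  shows "v (to_fract f) = truncation F v Q f \<longleftrightarrow> delta F v f \<le> delta F v Q"
proof -
  have Q': "Q \<in> nonconst_polys F"
    using Q by (auto simp: key_polynomial_def)
  obtain a where a: "a \<in> alg_cl F" "poly Q a = 0" "delta F v Q = v (to_fract [:- a, 1:])"
    using delta_facts(2)[OF Q'] by blast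
  obtain \<gamma> where \<gamma>: "v (to_fract [:- a, 1:]) = Fin \<gamma>"
    using linear_finite[OF a(1)] by blast
  have f': "f \<in> polys_over F" "f \<in> polys_over (alg_cl F)" "f \<noteq> 0"
    using f by (auto simp: nonconst_polys_def intro: polys_over_alg_cl)
  have "v (to_fract f) = truncation F v Q f \<longleftrightarrow> gauss_poly w a \<gamma> f = v (to_fract f)"
    unfolding truncation_eq_gauss[OF Q a \<gamma> f'(1)] by (rule eq_commute)
  also have "\<dots> \<longleftrightarrow> delta F v f \<le> Fin \<gamma>"
    unfolding delta_facts(1)[OF f] by (rule gauss_eq_V_iff[OF a(1) \<gamma> f'(2,3)])
  finally show ?thesis
    unfolding a(3) \<gamma> .
qed

end

section \<open>Algebraic elements and rational functions\<close>

text \<open>If one summand alone had the least value, the sum would have that finite value and could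
  not vanish.\<close>

lemma (in valued_ring) sum_eq_0_min_twice:
  assumes "finite A" and f: "\<And>i. i \<in> A \<Longrightarrow> f i \<in> S" and "sum f A = 0" and k: "k \<in> A" "f k \<noteq> 0"
  shows "\<exists>i\<in>A. \<exists>j\<in>A. i \<noteq> j \<and> f i \<noteq> 0 \<and> f j \<noteq> 0 \<and> v (f i) = v (f j)"
proof -
  define i where "i = arg_min_on (v \<circ> f) A"
  have ne: "A \<noteq> {}"
    using k by auto
  have i: "i \<in> A" and min: "\<And>j. j \<in> A \<Longrightarrow> v (f i) \<le> v (f j)"
    using arg_min_if_finite(1)[OF \<open>finite A\<close> ne, of "v \<circ> f"]
      arg_min_least[OF \<open>finite A\<close> ne, of _ "v \<circ> f"] unfolding i_def by auto
  have fin: "v (f i) < \<infinity>"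
  proof -
    obtain g where "v (f k) = Fin g"
      using v_finite[OF f[OF k(1)] k(2)] by blast
    then have "v (f i) \<le> Fin g"
      using min[OF k(1)] by simp
    also have "\<dots> < \<infinity>"
      by simp
    finally show ?thesis .
  qed
  have "\<exists>j\<in>A - {i}. v (f j) \<le> v (f i)"
  proof (rule ccontr)
    assume *: "\<not> (\<exists>j\<in>A - {i}. v (f j) \<le> v (f i))"
    have "v (f i) < v (sum f (A - {i}))"
      using * f by (intro v_sum_gt[OF _ fin]) (auto simp: not_le)
    then have eq: "v (f i + sum f (A - {i})) = v (f i)"
      using f i by (intro v_add_eq S_sum) auto
    have "f i + sum f (A - {i}) = 0"
      using sum.remove[OF \<open>finite A\<close> i, of f] \<open>sum f A = 0\<close> by simp
    then show False
      using eq fin unfolding \<open>f i + sum f (A - {i}) = 0\<close> by simp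
  qed
  then obtain j where j: "j \<in> A" "j \<noteq> i" "v (f j) \<le> v (f i)"
    by blast
  then have eq: "v (f i) = v (f j)"
    using min by (intro antisym) auto
  then have "f i \<noteq> 0" "f j \<noteq> 0"
    using fin by auto
  then show ?thesis
    using i j(1,2) eq by (intro bexI[of _ i] bexI[of _ j]) auto
qed

lemma nsmul_ge_self: "0 \<le> x \<Longrightarrow> n \<noteq> 0 \<Longrightarrow> x \<le> nsmul n (x :: 'g::linordered_ab_group_add)"
proof (induction n)
  case (Suc n)
  then show ?case
    by (cases "n = 0") (auto simp: add_increasing)
qed auto

context valued_field
begin

lemma v_inverse:
  assumes "x \<in> F" "w x = Fin g"
  shows "w (inverse x) = Fin (- g)"
proof -
  have "x \<noteq> 0"
    using assms by auto
  then have "w x + w (inverse x) = 0"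
    using v_mult[of x "inverse x"] assms inverse_mem by simp
  then show ?thesis
    unfolding assms(2) by (cases "w (inverse x)") (auto simp: zero_extended_def eq_neg_iff_add_eq_0 add.commute)
qed

text \<open>In an algebraic equation for c two nonzero terms of different degrees i < j have equal
  value, so (j - i) times the value of c is the value of a quotient of two coefficients.\<close>

lemma algebraic_torsion:
  assumes B: "field_set B" "B \<subseteq> F" and c: "c \<in> F" "c \<in> alg_cl B" and g: "w c = Fin g"
  shows "\<exists>n d. n \<noteq> 0 \<and> d \<in> B \<and> d \<noteq> 0 \<and> w d = Fin (nsmul n g)"
proof -
  interpret B: field_set B by fact
  obtain p where p: "p \<in> polys_over B" "p \<noteq> 0" "poly p c = 0"
    using c(2) by (auto simp: alg_cl_def)
  let ?f = "\<lambda>i. Polynomial.coeff p i * c ^ i"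
  have pB: "Polynomial.coeff p i \<in> B" "Polynomial.coeff p i \<in> F" for i
    using B.coeff_mem[OF p(1)] B(2) by auto
  have c0: "c \<noteq> 0"
    using g by auto
  have "\<exists>i\<in>{..Polynomial.degree p}. \<exists>j\<in>{..Polynomial.degree p}. i \<noteq> j \<and> ?f i \<noteq> 0 \<and> ?f j \<noteq> 0 \<and> w (?f i) = w (?f j)"
    using p pB c c0
    by (intro sum_eq_0_min_twice[where k = "Polynomial.degree p"])
       (auto simp: poly_altdef intro: mult_mem power_mem)
  then obtain i j where ij: "i < j" "?f i \<noteq> 0" "?f j \<noteq> 0" "w (?f i) = w (?f j)"
    by (metis linorder_neqE_nat)
  obtain a b where ab: "w (Polynomial.coeff p i) = Fin a" "w (Polynomial.coeff p j) = Fin b"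
    using v_finite[OF pB(2), of i] v_finite[OF pB(2), of j] ij by auto
  define n where "n = j - i"
  have "a + nsmul i g = b + nsmul j g"
    using ij(4) pB c g ab by (simp add: v_mult v_power power_mem)
  also have "j = i + n"
    using ij(1) by (simp add: n_def)
  finally have n: "nsmul n g = a + (- b)"
    by (simp add: nsmul_add algebra_simps)
  let ?d = "Polynomial.coeff p i * inverse (Polynomial.coeff p j)"
  have "w ?d = Fin (nsmul n g)"
    unfolding n using pB ab v_inverse[OF pB(2) ab(2)] by (simp add: v_mult inverse_mem)
  moreover have "?d \<in> B" "?d \<noteq> 0"
    using pB ij by (auto intro: B.mult_mem B.inverse_mem)
  moreover have "n \<noteq> 0"
    using ij(1) by (simp add: n_def)
  ultimately show ?thesis
    by blast
qed

text \<open>A nonnegative value is dominated by its positive multiples, one of which is attained on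
  B; a negative value is dominated by that of 1.\<close>

lemma algebraic_cofinal:
  assumes B: "field_set B" "B \<subseteq> F" and c: "c \<in> F" "c \<in> alg_cl B" and g: "w c = Fin g"
  shows "\<exists>d\<in>B. d \<noteq> 0 \<and> Fin g \<le> w d"
proof (cases "0 \<le> g")
  case True
  obtain n d where "n \<noteq> 0" "d \<in> B" "d \<noteq> 0" "w d = Fin (nsmul n g)"
    using algebraic_torsion[OF assms] by blast
  then show ?thesis
    using nsmul_ge_self[OF True, of n] by auto
next
  case False
  interpret B: field_set B by fact
  show ?thesis
    using False by (intro bexI[of _ 1]) (auto simp: zero_extended_def)
qed

text \<open>\<open>r\<close> has the same leading term as a nonzero element of \<open>C\<close>.\<close>

definition near :: "'a set \<Rightarrow> 'a \<Rightarrow> bool" where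
  "near C r \<longleftrightarrow> (\<exists>c\<in>C. w r < w (r - c))"

lemma near_value:
  assumes "r \<in> F" "c \<in> F" "w r < w (r - c)"
  shows "w c = w r"
  using v_diff_eq[OF assms] .

text \<open>With w c = w r, both summands of r s - c d = (r - c) s + c (s - d) have larger value
  than r s.\<close>

lemma near_mult:
  assumes C: "field_set C" "C \<subseteq> F" and r: "r \<in> F" "r \<noteq> 0" "near C r" and s: "s \<in> F" "s \<noteq> 0" "near C s"
  shows "near C (r * s)"
proof -
  interpret C: field_set C by fact
  obtain c d where c: "c \<in> C" "w r < w (r - c)" and d: "d \<in> C" "w s < w (s - d)"
    using r s by (auto simp: near_def)
  have mem: "c \<in> F" "d \<in> F" "r - c \<in> F" "s - d \<in> F"
    using c d C r s by (auto intro: diff_mem)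
  have eq: "w c = w r"
    using near_value[OF r(1) mem(1) c(2)] .
  have c0: "c \<noteq> 0"
    using c(2) by auto
  have "w (r * s) < w ((r - c) * s)"
    using r s mem c by (intro v_mult_strict) auto
  moreover have "w (r * s) < w (c * (s - d))"
  proof -
    have "w (c * s) < w (c * (s - d))"
      using s mem d c0 by (intro v_mult_strict) auto
    then show ?thesis
      using eq r s mem by (simp add: v_mult)
  qed
  ultimately have "w (r * s) < min (w ((r - c) * s)) (w (c * (s - d)))"
    by simp
  also have "\<dots> \<le> w ((r - c) * s + c * (s - d))"
    using r s mem by (intro v_add mult_mem) auto
  also have "(r - c) * s + c * (s - d) = r * s - c * d"
    by (simp add: algebra_simps)
  finally show ?thesis
    unfolding near_def using c d by (intro bexI[of _ "c * d"] C.mult_mem)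
qed

text \<open>The error 1/r - 1/c is (c - r) / (r c), and r and c have the same value.\<close>

lemma near_inverse:
  assumes C: "field_set C" "C \<subseteq> F" and r: "r \<in> F" "r \<noteq> 0" "near C r"
  shows "near C (inverse r)"
proof -
  interpret C: field_set C by fact
  obtain c where c: "c \<in> C" "w r < w (r - c)"
    using r by (auto simp: near_def)
  have mem: "c \<in> F" "r - c \<in> F" "inverse r \<in> F" "inverse c \<in> F" "c - r \<in> F"
    using c C r by (auto intro: diff_mem inverse_mem)
  have c0: "c \<noteq> 0"
    using c(2) by auto
  obtain g where g: "w r = Fin g"
    using v_finite r by blast
  have gc: "w c = Fin g"
    using near_value[OF r(1) mem(1) c(2)] g by simp
  have "inverse r - inverse c = (c - r) * (inverse r * inverse c)"
    using r c0 by (simp add: field_simps)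
  then have "w (inverse r - inverse c) = w (r - c) + Fin (- g + - g)"
    using mem r v_inverse[OF r(1) g] v_inverse[OF mem(1) gc] v_diff_commute[OF r(1) mem(1)]
    by (simp add: v_mult mult_mem)
  moreover have "Fin (- g) < w (r - c) + Fin (- g + - g)"
    using c(2) unfolding g by (cases "w (r - c)") (auto simp: algebra_simps)
  ultimately have "w (inverse r) < w (inverse r - inverse c)"
    using v_inverse[OF r(1) g] by simp
  then show ?thesis
    unfolding near_def using c C.inverse_mem by blast
qed

text \<open>Two representations of a fraction satisfy p q' = p' q. Multiplicativity turns this into
  equal differences of values, so the \<open>THE\<close> in \<open>gauss_val\<close> is well
  defined.\<close>

lemma gauss_val_Fract:
  assumes a: "a \<in> F" and p: "p \<in> polys_over F" and q: "q \<in> polys_over F" "q \<noteq> 0"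
  shows "gauss_val F w a \<gamma> (Fraction_Field.Fract p q) = gauss_poly w a \<gamma> p - gauss_poly w a \<gamma> q"
proof -
  let ?G = "gauss_poly w a \<gamma>"
  interpret G: valued_ring "polys_over F" ?G
    using a by (rule valued_ring_gauss_poly)
  have "?G p' - ?G q' = ?G p - ?G q"
    if p': "p' \<in> polys_over F" and q': "q' \<in> polys_over F" "q' \<noteq> 0"
      and eq: "Fraction_Field.Fract p q = Fraction_Field.Fract p' q'" for p' q'
  proof -
    have "p * q' = p' * q"
      using eq q q' by (simp add: eq_fract)
    then have "?G p + ?G q' = ?G p' + ?G q"
      using G.v_mult[OF p q'(1)] G.v_mult[OF p' q(1)] by simp
    moreover obtain g where "?G q = Fin g"
      using G.v_finite q by blast
    moreover obtain g' where "?G q' = Fin g'"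
      using G.v_finite q' by blast
    ultimately show ?thesis
      using G.v_neq_Minf[OF p] G.v_neq_Minf[OF p']
      by (cases "?G p"; cases "?G p'") (auto simp: algebra_simps)
  qed
  then show ?thesis
    unfolding gauss_val_def using p q by (intro the_equality) blast+
qed

lemma gauss_val_to_fract:
  assumes a: "a \<in> F" and p: "p \<in> polys_over F"
  shows "gauss_val F w a \<gamma> (to_fract p) = gauss_poly w a \<gamma> p"
proof -
  have "gauss_poly w a \<gamma> 1 = 0"
    using gauss_poly_const[of a \<gamma> 1] by (simp add: one_pCons)
  moreover have "x - 0 = x" for x :: "'g extended"
    unfolding zero_extended_def by (cases x) auto
  ultimately show ?thesis
    using gauss_val_Fract[OF a p polys_over_1, of \<gamma>] by (simp add: to_fract_def)
qed

end

section \<open>Rational function fields and their constants\<close>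

lemma (in field_set) mem_ratfuns_iff:
  "r \<in> ratfuns F \<longleftrightarrow> (\<exists>p q. p \<in> polys_over F \<and> q \<in> polys_over F \<and> q \<noteq> 0 \<and> r = to_fract p * inverse (to_fract q))"
proof -
  have eq: "Fraction_Field.Fract p q = to_fract p * inverse (to_fract q)" for p q :: "'a poly"
    by (simp add: to_fract_def)
  show ?thesis
    unfolding ratfuns_def eq by blast
qed

lemma (in field_set) to_fract_mem: "p \<in> polys_over F \<Longrightarrow> to_fract p \<in> ratfuns F"
  unfolding ratfuns_def to_fract_def by (intro CollectI exI[of _ p] exI[of _ 1]) auto

lemma field_set_ratfuns:
  assumes "field_set F"
  shows "field_set (ratfuns F)"
proof -
  interpret field_set F by fact
  show ?thesis
  proof
    show "0 \<in> ratfuns F" "1 \<in> ratfuns F"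
      using to_fract_mem[of 0] to_fract_mem[of 1] by simp_all
  next
    fix x y assume "x \<in> ratfuns F" "y \<in> ratfuns F"
    then obtain p q p' q' where pq: "p \<in> polys_over F" "q \<in> polys_over F" "q \<noteq> 0" "x = Fraction_Field.Fract p q"
      "p' \<in> polys_over F" "q' \<in> polys_over F" "q' \<noteq> 0" "y = Fraction_Field.Fract p' q'"
      by (auto simp: ratfuns_def)
    have "x + y = Fraction_Field.Fract (p * q' + p' * q) (q * q')" "x * y = Fraction_Field.Fract (p * p') (q * q')"
      using pq by simp_all
    moreover have "p * q' + p' * q \<in> polys_over F" "q * q' \<in> polys_over F" "p * p' \<in> polys_over F" "q * q' \<noteq> 0"
      using pq by (auto intro: polys_over_add polys_over_mult)
    ultimately show "x + y \<in> ratfuns F" "x * y \<in> ratfuns F"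
      unfolding ratfuns_def by blast+
  next
    fix x assume "x \<in> ratfuns F"
    then obtain p q where pq: "p \<in> polys_over F" "q \<in> polys_over F" "q \<noteq> 0" "x = Fraction_Field.Fract p q"
      by (auto simp: ratfuns_def)
    have "- x = Fraction_Field.Fract (- p) q"
      using pq by simp
    then show "- x \<in> ratfuns F"
      unfolding ratfuns_def using pq polys_over_uminus by blast
    show "inverse x \<in> ratfuns F"
    proof (cases "p = 0")
      case True
      then have "inverse x = 0"
        using pq by (simp add: fract_collapse)
      then show ?thesis
        using to_fract_mem[of 0] by simp
    next
      case False
      have "inverse x = Fraction_Field.Fract q p"
        using pq by simp
      then show ?thesis
        unfolding ratfuns_def using pq False by blast
    qed
  qed
qed

lemma ratfuns_mono: "F \<subseteq> E \<Longrightarrow> ratfuns F \<subseteq> ratfuns E"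
  using polys_over_mono[of F E] unfolding ratfuns_def by blast

lemma of_const_simps:
  "of_const 0 = 0" "of_const 1 = 1" "of_const (x + y) = of_const x + of_const y"
  "of_const (- x) = - of_const x" "of_const (x * y) = of_const x * of_const y"
  "of_const (inverse x) = inverse (of_const x)" "of_const (x - y) = of_const x - of_const y"
  "of_const x = 0 \<longleftrightarrow> x = 0"
proof -
  show *: "of_const 0 = 0" "of_const 1 = 1" "of_const (x + y) = of_const x + of_const y"
    "of_const (- x) = - of_const x" "of_const (x * y) = of_const x * of_const y" 
    "of_const (x - y) = of_const x - of_const y" "of_const x = 0 \<longleftrightarrow> x = 0" for x y
    by (simp_all add: of_const_def flip: one_pCons to_fract_add to_fract_uminus to_fract_mult to_fract_diff)
  show "of_const (inverse x) = inverse (of_const x)"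
  proof (cases "x = 0")
    case False
    then have "of_const x * of_const (inverse x) = 1"
      by (simp flip: *(5) add: *(2))
    then show ?thesis
      by (simp add: inverse_unique)
  qed (simp add: *(1))
qed

lemma of_const_power: "of_const (x ^ n) = of_const x ^ n"
  by (induction n) (auto simp: of_const_simps)

lemma of_const_sum: "of_const (sum f A) = (\<Sum>i\<in>A. of_const (f i))"
  by (induction A rule: infinite_finite_induct) (auto simp: of_const_simps)

lemma (in field_set) of_const_mem: "c \<in> F \<Longrightarrow> of_const c \<in> ratfuns F"
  unfolding of_const_def by (intro to_fract_mem) (simp add: polys_over_const)

lemma field_set_of_const:
  assumes "field_set F"
  shows "field_set (of_const ` F)"
proof -
  interpret field_set F by fact
  show ?thesis
  proof
    show "0 \<in> of_const ` F" "1 \<in> of_const ` F"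
      by (auto simp: of_const_simps intro!: rev_image_eqI[of 0] rev_image_eqI[of 1])
  qed (auto simp flip: of_const_simps(3-6) intro!: imageI add_mem uminus_mem mult_mem inverse_mem)
qed

lemma valued_field_iff_krull:
  assumes "field_set F"
  shows "krull_valuation (field_on F) v \<longleftrightarrow> valued_field F v"
proof -
  interpret field_set F by fact
  show ?thesis
    unfolding krull_valuation_def valued_field_def valued_ring_def type_algebra_simps
    using assms add_mem uminus_mem mult_mem zero_mem one_mem
    by (auto simp: ring_of_type_algebra_def)
qed

section \<open>Rational rank and torsion\<close>

text \<open>Torsion is killed by tensoring with a divisible group: if x to the power n is trivial,
  then moving n across the tensor sign turns x and q = n (q/n) into the trivial element paired with
  q/n, which is a relation.\<close>

lemma tensor_relations_torsion:
  fixes G (structure)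
  assumes "group G" and torsion: "\<And>x. x \<in> carrier G \<Longrightarrow> \<exists>n. n \<noteq> (0::nat) \<and> x [^] n = \<one>"
  shows "tensor_relations G rat_group = carrier (tensor_free G rat_group)"
proof -
  interpret G: group G by fact
  let ?T = "tensor_free G rat_group" and ?N = "tensor_relations G rat_group"
  have T: "group ?T"
    by (simp add: tensor_free_def)
  interpret T: group ?T by fact
  have rat [simp]: "carrier rat_group = UNIV" "x \<otimes>\<^bsub>rat_group\<^esub> y = x + y" for x y
    by (simp_all add: add_group_on_def)
  let ?gens = "{frag_of (x \<otimes> x', y) - frag_of (x, y) - frag_of (x', y) | x x' y.
         x \<in> carrier G \<and> x' \<in> carrier G \<and> y \<in> carrier rat_group} \<union>
      {frag_of (x, y \<otimes>\<^bsub>rat_group\<^esub> y') - frag_of (x, y) - frag_of (x, y') | x y y'.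
         x \<in> carrier G \<and> y \<in> carrier rat_group \<and> y' \<in> carrier rat_group}"
  have keys: "Poly_Mapping.keys (frag_of a - frag_of b - frag_of c) \<subseteq> S" if "a \<in> S" "b \<in> S" "c \<in> S"
    for a b c :: "'a \<times> rat" and S
    using that keys_diff[of "frag_of a - frag_of b" "frag_of c"] keys_diff[of "frag_of a" "frag_of b"] by auto
  have gens: "?gens \<subseteq> carrier ?T"
  proof
    fix c assume "c \<in> ?gens"
    then consider x x' y where "c = frag_of (x \<otimes> x', y) - frag_of (x, y) - frag_of (x', y)"
        "x \<in> carrier G" "x' \<in> carrier G"
      | x y y' where "c = frag_of (x, y + y') - frag_of (x, y) - frag_of (x, y')" "x \<in> carrier G"
      by (auto simp only: rat)
    then show "c \<in> carrier ?T"
      by cases (simp_all add: tensor_free_def keys)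
  qed
  have N: "subgroup ?N ?T"
    unfolding tensor_relations_def by (rule T.generate_is_subgroup[OF gens])
  have N_carrier: "c \<in> ?N \<Longrightarrow> Poly_Mapping.keys c \<subseteq> carrier G \<times> UNIV" for c
    using subgroup.mem_carrier[OF N, of c] by (simp add: tensor_free_def)
  have N_add: "c + d \<in> ?N" if "c \<in> ?N" "d \<in> ?N" for c d
    using subgroup.m_closed[OF N that] by (simp add: tensor_free_def)
  have N_uminus: "- c \<in> ?N" if "c \<in> ?N" for c
    using subgroup.m_inv_closed[OF N that] N_carrier[OF that] by (simp add: tensor_free_def)
  have N_diff: "c - d \<in> ?N" if "c \<in> ?N" "d \<in> ?N" for c d
    using N_add[OF that(1) N_uminus[OF that(2)]] by simp
  have N_0: "0 \<in> ?N"
    using subgroup.one_closed[OF N] by (simp add: tensor_free_def)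
  have left: "frag_of (x \<otimes> x', y) - frag_of (x, y) - frag_of (x', y) \<in> ?N"
    if "x \<in> carrier G" "x' \<in> carrier G" for x x' y
    unfolding tensor_relations_def using that by (intro generate.incl) auto
  have right: "frag_of (x, y + y') - frag_of (x, y) - frag_of (x, y') \<in> ?N"
    if "x \<in> carrier G" for x y y'
    unfolding tensor_relations_def using that by (intro generate.incl) auto
  \<comment> \<open>With both factors equal to the unit, the relation collapses to the negative of
    this generator; \<open>zero\<close> arises in the same way from 0 + 0.\<close>
  have one: "frag_of (\<one>, y) \<in> ?N" for y
    using N_uminus[OF left[of \<one> \<one> y]] by simp
  have zero: "frag_of (x, 0) \<in> ?N" if "x \<in> carrier G" for x
    using N_uminus[OF right[OF that, of 0 0]] by simp
  have move: "frag_of (x, of_nat k * y) - frag_of (x [^] k, y) \<in> ?N" if x: "x \<in> carrier G" for x y and k :: nat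
  proof (induction k)
    case 0
    show ?case
      using N_diff[OF zero[OF x] one] by simp
  next
    case (Suc k)
    have "frag_of (x, of_nat k * y + y) - frag_of (x, of_nat k * y) - frag_of (x, y)
        - (frag_of (x [^] k \<otimes> x, y) - frag_of (x [^] k, y) - frag_of (x, y))
        + (frag_of (x, of_nat k * y) - frag_of (x [^] k, y)) \<in> ?N"
      by (rule N_add[OF N_diff[OF right[OF x] left[OF G.nat_pow_closed[OF x] x]] Suc])
    also have "frag_of (x, of_nat k * y + y) - frag_of (x, of_nat k * y) - frag_of (x, y)
        - (frag_of (x [^] k \<otimes> x, y) - frag_of (x [^] k, y) - frag_of (x, y))
        + (frag_of (x, of_nat k * y) - frag_of (x [^] k, y))
      = frag_of (x, of_nat (Suc k) * y) - frag_of (x [^] Suc k, y)"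
      by (simp add: algebra_simps)
    finally show ?case .
  qed
  have gen: "frag_of (x, q) \<in> ?N" if x: "x \<in> carrier G" for x q
  proof -
    obtain n where n: "n \<noteq> (0::nat)" "x [^] n = \<one>"
      using torsion[OF x] by blast
    have "of_nat n * (q / of_nat n) = q"
      using n by simp
    then show ?thesis
      using N_add[OF move[OF x, of n "q / of_nat n"] one[of "q / of_nat n"]] n(2) by simp
  qed
  show ?thesis
  proof (rule antisym[OF subgroup.subset[OF N]], rule subsetI)
    fix c assume "c \<in> carrier ?T"
    then have "Poly_Mapping.keys c \<subseteq> carrier G \<times> UNIV"
      by (simp add: tensor_free_def)
    then show "c \<in> ?N"
    proof (induction c rule: frag_induction)
      case (one a)
      then show ?case
        using gen by (cases a) auto
    qed (use N_0 N_diff in blast)+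
  qed
qed

text \<open>The tensor product has a single coset, which every scalar maps to itself. The scalars 0
  and 1 then contradict uniqueness of the coordinate.\<close>

lemma torsion_not_rational_rank_one:
  fixes G (structure)
  assumes G: "group G" and torsion: "\<And>x. x \<in> carrier G \<Longrightarrow> \<exists>n. n \<noteq> (0::nat) \<and> x [^] n = \<one>"
  shows "\<not> rational_rank_one G"
proof
  assume "rational_rank_one G"
  then obtain t where t: "t \<in> carrier (tensor G rat_group)"
    and scale: "\<forall>u\<in>carrier (tensor G rat_group). \<exists>!q. u = rat_scale G q t"
    unfolding rational_rank_one_def by (elim bexE)
  have uniq: "\<exists>!q. t = rat_scale G q t"
    using scale t by (rule bspec)
  let ?T = "tensor_free G rat_group"
  interpret T: group ?T
    by (simp add: tensor_free_def)
  have N: "tensor_relations G rat_group = carrier ?T"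
    using assms by (rule tensor_relations_torsion)
  have carrier_T: "c \<in> carrier ?T \<longleftrightarrow> Poly_Mapping.keys c \<subseteq> carrier G \<times> UNIV" for c
    by (simp add: tensor_free_def add_group_on_def)
  obtain c where c: "c \<in> carrier ?T" "t = carrier ?T #>\<^bsub>?T\<^esub> c"
    using t unfolding tensor_def N by (auto simp: FactGroup_def RCOSETS_def)
  have t_eq: "t = carrier ?T"
    unfolding c(2) by (rule T.coset_join2[OF c(1) T.subgroup_self c(1)])
  have "rat_scale G q t = carrier ?T" for q
  proof -
    let ?f = "frag_extend (\<lambda>(x, r). frag_of (x, q * r))"
    have f: "?f d \<in> carrier ?T" if "d \<in> carrier ?T" for d
      using that keys_frag_extend[of "\<lambda>(x, r). frag_of (x, q * r)" d] unfolding carrier_T by fastforce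
    show ?thesis
      unfolding rat_scale_def N t_eq
    proof
      show "carrier ?T <#>\<^bsub>?T\<^esub> ?f ` carrier ?T \<subseteq> carrier ?T"
        using f by (auto simp: set_mult_def)
      show "carrier ?T \<subseteq> carrier ?T <#>\<^bsub>?T\<^esub> ?f ` carrier ?T"
      proof
        fix d assume d: "d \<in> carrier ?T"
        have one: "?f \<one>\<^bsub>?T\<^esub> \<in> carrier ?T"
          by (rule f) simp
        have "d = (d \<otimes>\<^bsub>?T\<^esub> inv\<^bsub>?T\<^esub> ?f \<one>\<^bsub>?T\<^esub>) \<otimes>\<^bsub>?T\<^esub> ?f \<one>\<^bsub>?T\<^esub>"
          using d one by (simp add: T.m_assoc)
        moreover have "d \<otimes>\<^bsub>?T\<^esub> inv\<^bsub>?T\<^esub> ?f \<one>\<^bsub>?T\<^esub> \<in> carrier ?T"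
          using d one by simp
        ultimately show "d \<in> carrier ?T <#>\<^bsub>?T\<^esub> ?f ` carrier ?T"
          unfolding set_mult_def by blast
      qed
    qed
  qed
  then have "t = rat_scale G 0 t" "t = rat_scale G 1 t"
    using t_eq by simp_all
  with uniq have "(0::rat) = 1"
    by (elim ex1E) (metis zero_neq_one)
  then show False
    by simp
qed

section \<open>Additive groups and their quotients\<close>

lemma add_group_on_simps [simp]:
  "carrier (add_group_on A) = A" "x \<otimes>\<^bsub>add_group_on A\<^esub> y = x + y" "\<one>\<^bsub>add_group_on A\<^esub> = 0"
  by (simp_all add: add_group_on_def)

lemma comm_group_add_group_on:
  fixes A :: "'g::ab_group_add set"
  assumes "0 \<in> A" "\<And>x y. x \<in> A \<Longrightarrow> y \<in> A \<Longrightarrow> x + y \<in> A" "\<And>x. x \<in> A \<Longrightarrow> - x \<in> A"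
  shows "comm_group (add_group_on A)"
proof (rule comm_groupI)
  fix x assume "x \<in> carrier (add_group_on A)"
  then show "\<exists>y\<in>carrier (add_group_on A). y \<otimes>\<^bsub>add_group_on A\<^esub> x = \<one>\<^bsub>add_group_on A\<^esub>"
    using assms(3)[of x] by (intro bexI[of _ "- x"]) auto
qed (use assms in \<open>auto simp: algebra_simps\<close>)

lemma add_group_on_inv:
  fixes A :: "'g::ab_group_add set"
  assumes "comm_group (add_group_on A)" "x \<in> A" "- x \<in> A"
  shows "inv\<^bsub>add_group_on A\<^esub> x = - x"
  by (rule group.inv_equality) (use assms in \<open>auto simp: comm_group_def\<close>)

text \<open>If every x in A had a nonzero multiple in B, the quotient would be torsion: powers in
  the multiplicatively written quotient are cosets of the multiples
  \<open>nsmul n x\<close>.\<close>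

lemma rational_rank_one_imp_not_torsion:
  fixes A B :: "'g::ab_group_add set"
  assumes A: "0 \<in> A" "\<And>x y. x \<in> A \<Longrightarrow> y \<in> A \<Longrightarrow> x + y \<in> A" "\<And>x. x \<in> A \<Longrightarrow> - x \<in> A"
    and B: "B \<subseteq> A" "0 \<in> B" "\<And>x y. x \<in> B \<Longrightarrow> y \<in> B \<Longrightarrow> x + y \<in> B" "\<And>x. x \<in> B \<Longrightarrow> - x \<in> B"
    and "rational_rank_one (add_group_on A Mod B)"
  shows "\<exists>x\<in>A. \<forall>n. n \<noteq> 0 \<longrightarrow> nsmul n x \<notin> B"
proof (rule ccontr)
  assume *: "\<not> (\<exists>x\<in>A. \<forall>n. n \<noteq> 0 \<longrightarrow> nsmul n x \<notin> B)"
  interpret A: comm_group "add_group_on A"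
    using A by (rule comm_group_add_group_on)
  have sub: "subgroup B (add_group_on A)"
    using B A by (intro A.subgroupI) (auto simp: add_group_on_inv[OF A.comm_group_axioms])
  then interpret B: normal B "add_group_on A"
    by (rule A.subgroup_imp_normal)
  have pow: "nsmul n x \<in> A \<and> (B #>\<^bsub>add_group_on A\<^esub> x) [^]\<^bsub>add_group_on A Mod B\<^esub> n = B #>\<^bsub>add_group_on A\<^esub> nsmul n x"
    if x: "x \<in> A" for x n
  proof (induction n)
    case 0
    have "B #>\<^bsub>add_group_on A\<^esub> 0 = B"
      using A.coset_mult_one[of B] B(1) by simp
    then show ?case
      using A by simp
  next
    case (Suc n)
    then show ?case
      using A x B.rcos_sum[of "nsmul n x" x] by (simp add: FactGroup_def)
  qed
  have "\<not> rational_rank_one (add_group_on A Mod B)"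
  proof (rule torsion_not_rational_rank_one[OF B.factorgroup_is_group])
    fix C assume "C \<in> carrier (add_group_on A Mod B)"
    then obtain x where x: "x \<in> A" "C = B #>\<^bsub>add_group_on A\<^esub> x"
      by (auto simp: FactGroup_def RCOSETS_def)
    obtain n where n: "n \<noteq> 0" "nsmul n x \<in> B"
      using * x(1) by blast
    have "B #>\<^bsub>add_group_on A\<^esub> nsmul n x = B"
      using n(2) B(1) sub by (intro A.coset_join2) auto
    then show "\<exists>n. n \<noteq> (0::nat) \<and> C [^]\<^bsub>add_group_on A Mod B\<^esub> n = \<one>\<^bsub>add_group_on A Mod B\<^esub>"
      using pow[OF x(1), of n] n(1) x(2) by (intro exI[of _ n]) (simp add: FactGroup_def)
  qed
  with assms show False
    by blast
qed

section \<open>Algebraic residues\<close>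

lemma (in valued_ring) v_power_nonneg: "x \<in> S \<Longrightarrow> 0 \<le> v x \<Longrightarrow> 0 \<le> v (x ^ n)"
proof (induction n)
  case (Suc n)
  then show ?case
    using add_mono[of 0 "v x" 0 "v (x ^ n)"] by (simp add: v_mult S_power)
qed simp

text \<open>
  An algebraic relation for \<open>c\<close>, divided by a coefficient of least value, reduces to a relation for
  the residue of \<open>f\<close>; cutting at the last coefficient of value \<open>0\<close> keeps its leading coefficient nonzero.
\<close>

lemma (in valued_field) residue_relation:
  assumes B: "field_set B" "B \<subseteq> F" and f: "f \<in> F" "0 \<le> w f" and c: "c \<in> F" "0 < w (f - c)"
    and p: "\<And>i. p i \<in> B" "p N \<noteq> 0" "(\<Sum>i\<le>N. p i * c ^ i) = 0"
  shows "\<exists>n k. (\<forall>i\<le>n. k i \<in> B \<and> 0 \<le> w (k i)) \<and> w (k n) = 0 \<and> 0 < w (\<Sum>i\<le>n. k i * f ^ i)"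
proof -
  interpret B: field_set B by fact
  define m where "m = arg_min_on (w \<circ> p) {..N}"
  have m: "m \<le> N" and min: "\<And>j. j \<le> N \<Longrightarrow> w (p m) \<le> w (p j)"
    using arg_min_if_finite(1)[of "{..N}" "w \<circ> p"] arg_min_least[of "{..N}" _ "w \<circ> p"]
    unfolding m_def by auto
  have pF: "p i \<in> F" for i
    using p(1) B(2) by blast
  obtain b where "w (p N) = Fin b"
    using v_finite[OF pF p(2)] by blast
  then obtain a where a: "w (p m) = Fin a"
    using min[of N] v_neq_Minf[OF pF, of m] by (cases "w (p m)") auto
  define k where "k i = p i * inverse (p m)" for i
  have kB: "k i \<in> B" "k i \<in> F" for i
    using p(1) B(2) by (auto simp: k_def intro: B.mult_mem B.inverse_mem)
  have wk: "w (k i) = w (p i) + Fin (- a)" for i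
    using pF v_inverse[OF pF a] by (simp add: k_def v_mult inverse_mem)
  have km: "w (k m) = 0"
    by (simp add: wk a zero_extended_def)
  have k_ge: "0 \<le> w (k i)" if "i \<le> N" for i
    using min[OF that] unfolding wk a by (cases "w (p i)") (auto simp: zero_extended_def)
  define n where "n = Max {i. i \<le> N \<and> w (k i) = 0}"
  have fin: "finite {i. i \<le> N \<and> w (k i) = 0}" and ne: "{i. i \<le> N \<and> w (k i) = 0} \<noteq> {}"
    using m km by auto
  have n: "n \<le> N" "w (k n) = 0"
    using Max_in[OF fin ne] unfolding n_def by auto
  have k_gt: "0 < w (k i)" if "n < i" "i \<le> N" for i
    using Max_ge[OF fin, of i] k_ge[OF that(2)] that unfolding n_def[symmetric] by (auto simp: order_le_less)
  have zero_lt: "0 < (\<infinity> :: 'g extended)" "(0 :: 'g extended) \<noteq> \<infinity>" "(0 :: 'g extended) \<noteq> -\<infinity>"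
    by (simp_all add: zero_extended_def)
  have add_pos: "0 < x + y" "0 < y + x" if "0 < x" "0 \<le> y" for x y :: "'g extended"
    using extended_add_strict[of 0 x 0 y] that zero_lt by simp_all
  have mem_fc: "f - c \<in> F"
    using f c by (intro diff_mem)
  have "min (w f) (w (f - c)) \<le> w (f - (f - c))"
    using f mem_fc by (intro v_diff)
  then have wc: "0 \<le> w c"
    using f c by (auto simp: min_def split: if_splits)
  have pow_gt: "0 < w (f ^ i - c ^ i)" for i
  proof (induction i)
    case (Suc i)
    have mem: "f ^ i - c ^ i \<in> F" "f * (f ^ i - c ^ i) \<in> F" "(f - c) * c ^ i \<in> F"
      using f c by (auto intro!: diff_mem mult_mem power_mem)
    have "0 < w (f * (f ^ i - c ^ i))" "0 < w ((f - c) * c ^ i)"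
      using Suc f c mem mem_fc v_power_nonneg[OF c(1) wc, of i] by (auto simp: v_mult power_mem intro: add_pos)
    then have "0 < min (w (f * (f ^ i - c ^ i))) (w ((f - c) * c ^ i))"
      by simp
    also have "\<dots> \<le> w (f * (f ^ i - c ^ i) + (f - c) * c ^ i)"
      using mem by (intro v_add)
    also have "f * (f ^ i - c ^ i) + (f - c) * c ^ i = f ^ Suc i - c ^ Suc i"
      by (simp add: algebra_simps)
    finally show ?case .
  qed (simp add: zero_lt)
  \<comment> \<open>Since the relation vanishes at c, \<open>?D\<close> is the whole sum at f, and
    \<open>?H\<close> is its part above n. Both have positive value, hence so has the part up to
    n.\<close>
  let ?D = "\<Sum>i\<le>N. k i * (f ^ i - c ^ i)" and ?H = "\<Sum>i\<in>{n<..N}. k i * f ^ i"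
  have memD: "k i * (f ^ i - c ^ i) \<in> F" "k i * f ^ i \<in> F" for i
    using f c kB by (auto intro!: diff_mem mult_mem power_mem)
  have lt_inf: "(0 :: 'g extended) < \<infinity>"
    by (rule zero_lt)
  have D: "0 < w ?D"
  proof (rule v_sum_gt[OF _ lt_inf], intro conjI memD)
    fix i assume "i \<in> {..N}"
    then show "0 < w (k i * (f ^ i - c ^ i))"
      using k_ge[of i] pow_gt[of i] f c kB by (simp add: v_mult diff_mem power_mem add_pos)
  qed
  have H: "0 < w ?H"
  proof (rule v_sum_gt[OF _ lt_inf], intro conjI memD)
    fix i assume "i \<in> {n<..N}"
    then show "0 < w (k i * f ^ i)"
      using k_gt[of i] v_power_nonneg[OF f, of i] f kB by (simp add: v_mult power_mem add_pos)
  qed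
  have "(\<Sum>i\<le>N. k i * c ^ i) = inverse (p m) * (\<Sum>i\<le>N. p i * c ^ i)"
    by (simp add: k_def sum_distrib_left mult_ac)
  then have "(\<Sum>i\<le>N. k i * c ^ i) = 0"
    using p(3) by simp
  then have "?D = (\<Sum>i\<le>N. k i * f ^ i)"
    by (simp add: right_diff_distrib sum_subtractf)
  also have "\<dots> = (\<Sum>i\<in>{..n} \<union> {n<..N}. k i * f ^ i)"
    using n(1) by (intro sum.cong) auto
  also have "\<dots> = (\<Sum>i\<le>n. k i * f ^ i) + ?H"
    by (intro sum.union_disjoint) auto
  finally have split: "?D - ?H = (\<Sum>i\<le>n. k i * f ^ i)"
    by simp
  have "0 < min (w ?D) (w ?H)"
    using D H by simp
  also have "\<dots> \<le> w (?D - ?H)"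
    by (intro v_diff sum_mem memD)
  finally have "0 < w (\<Sum>i\<le>n. k i * f ^ i)"
    unfolding split .
  then show ?thesis
    using kB k_ge n by (intro exI[of _ n] exI[of _ k]) auto
qed

section \<open>The valuation ring and its residue field\<close>

locale valuation_residues = valued_field F w
  for F :: "'a::field set" and w :: "'a \<Rightarrow> 'g::linordered_ab_group_add extended"
begin

abbreviation "val_ring \<equiv> valuation_ring (field_on F) w"
abbreviation "val_ideal \<equiv> valuation_ideal (field_on F) w"

lemma val_ring_eq: "val_ring = ring_of_type_algebra\<lparr>carrier := {x \<in> F. 0 \<le> w x}\<rparr>"
  by (simp add: valuation_ring_def)

lemma val_ring_simps [simp]:
  "carrier val_ring = {x \<in> F. 0 \<le> w x}" "x \<otimes>\<^bsub>val_ring\<^esub> y = x * y" "x \<oplus>\<^bsub>val_ring\<^esub> y = x + y"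
  "\<zero>\<^bsub>val_ring\<^esub> = 0" "\<one>\<^bsub>val_ring\<^esub> = 1"
  by (simp_all add: val_ring_eq type_algebra_simps)

lemma val_ideal_eq: "val_ideal = {x \<in> F. 0 < w x}"
  by (simp add: valuation_ideal_def)

lemma zero_less_Pinf: "0 < (\<infinity> :: 'g extended)" "0 \<le> (\<infinity> :: 'g extended)"
  by (simp_all add: zero_extended_def)

lemma ring_val_ring: "ring val_ring"
proof -
  have "subring {x \<in> F. 0 \<le> w x} ring_of_type_algebra"
  proof (rule ring.subringI[OF ring_from_type_algebra])
    fix x y assume "x \<in> {x \<in> F. 0 \<le> w x}" "y \<in> {x \<in> F. 0 \<le> w x}"
    then show "x \<otimes>\<^bsub>ring_of_type_algebra\<^esub> y \<in> {x \<in> F. 0 \<le> w x}"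
      "x \<oplus>\<^bsub>ring_of_type_algebra\<^esub> y \<in> {x \<in> F. 0 \<le> w x}"
      using v_add[of x y] add_mono[of 0 "w x" 0 "w y"]
      by (auto simp: type_algebra_simps v_mult add_mem mult_mem min_def split: if_splits)
  qed (auto simp: type_algebra_simps type_algebra_a_inv uminus_mem)
  then show ?thesis
    unfolding val_ring_eq by (rule ring.subring_is_ring[OF ring_from_type_algebra])
qed

lemma ideal_val_ideal: "ideal val_ideal val_ring"
proof (rule idealI[OF ring_val_ring])
  interpret ring val_ring by (rule ring_val_ring)
  have neg: "\<ominus>\<^bsub>val_ring\<^esub> x = - x" if "x \<in> F" "0 \<le> w x" for x
    using that by (intro minus_equality) (auto simp: uminus_mem)
  show "subgroup val_ideal (add_monoid val_ring)"
  proof (rule add.subgroupI)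
    fix x y assume xy: "x \<in> val_ideal" "y \<in> val_ideal"
    have "min (w x) (w y) \<le> w (x + y)"
      using xy by (intro v_add) (auto simp: val_ideal_eq)
    then have "0 < w (x + y)"
      using xy by (auto simp: val_ideal_eq min_def split: if_splits)
    then show "x \<oplus>\<^bsub>val_ring\<^esub> y \<in> val_ideal"
      using xy by (auto simp: val_ideal_eq add_mem)
    show "\<ominus>\<^bsub>val_ring\<^esub> x \<in> val_ideal"
      using xy neg[of x] by (auto simp: val_ideal_eq uminus_mem)
  next
    show "val_ideal \<subseteq> carrier val_ring" "val_ideal \<noteq> {}"
      using zero_less_Pinf by (auto simp: val_ideal_eq intro!: exI[of _ 0])
  qed
  fix a x assume a: "a \<in> val_ideal" and x: "x \<in> carrier val_ring"
  have "0 < w x + w a"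
    using extended_add_strict(2)[of 0 "w a" 0 "w x"] a x by (auto simp: val_ideal_eq zero_extended_def)
  then show "x \<otimes>\<^bsub>val_ring\<^esub> a \<in> val_ideal" "a \<otimes>\<^bsub>val_ring\<^esub> x \<in> val_ideal"
    using a x by (auto simp: val_ideal_eq v_mult mult_mem add.commute)
qed

abbreviation "res \<equiv> residue_field (field_on F) w"
abbreviation "red x \<equiv> val_ideal +>\<^bsub>val_ring\<^esub> x"

lemma ring_res: "ring res"
  unfolding residue_field_def by (rule ideal.quotient_is_ring[OF ideal_val_ideal])

lemma red_hom: "(\<lambda>x. red x) \<in> ring_hom val_ring res"
  unfolding residue_field_def by (rule ideal.rcos_ring_hom[OF ideal_val_ideal])

lemma red_simps:
  assumes "x \<in> F" "0 \<le> w x" "y \<in> F" "0 \<le> w y"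
  shows "red (x * y) = red x \<otimes>\<^bsub>res\<^esub> red y" "red (x + y) = red x \<oplus>\<^bsub>res\<^esub> red y"
  using ring_hom_memE(2,3)[OF red_hom, of x y] assms by auto

lemma red_zero_iff:
  assumes "x \<in> F" "0 \<le> w x"
  shows "red x = \<zero>\<^bsub>res\<^esub> \<longleftrightarrow> 0 < w x"
proof -
  have zero: "\<zero>\<^bsub>res\<^esub> = val_ideal"
    by (simp add: residue_field_def FactRing_def)
  show ?thesis
  proof
    assume "red x = \<zero>\<^bsub>res\<^esub>"
    then have "x \<in> val_ideal"
      unfolding zero using assms by (intro ideal.rcos_const_imp_mem[OF ideal_val_ideal]) auto
    then show "0 < w x"
      by (simp add: val_ideal_eq)
  next
    assume "0 < w x"
    then have "x \<in> val_ideal"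
      using assms by (simp add: val_ideal_eq)
    moreover have "abelian_subgroup val_ideal val_ring"
      by (rule abelian_subgroupI3[OF ideal.axioms(1)[OF ideal_val_ideal] ring.is_abelian_group[OF ring_val_ring]])
    ultimately show "red x = \<zero>\<^bsub>res\<^esub>"
      unfolding zero by (intro abelian_subgroup.a_rcos_const)
  qed
qed

text \<open>The index list is reversed because \<open>ring.eval\<close> reads the leading
  coefficient first. Membership in the valuation ring is carried along so that
  \<open>red_simps\<close> applies to the partial sums.\<close>

lemma eval_red:
  assumes f: "f \<in> F" "0 \<le> w f" and k: "\<And>i. i < n \<Longrightarrow> k i \<in> F \<and> 0 \<le> w (k i)"
  shows "(\<Sum>i<n. k i * f ^ i) \<in> F \<and> 0 \<le> w (\<Sum>i<n. k i * f ^ i) \<and>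
    ring.eval res (map (\<lambda>i. red (k i)) (rev [0..<n])) (red f) = red (\<Sum>i<n. k i * f ^ i)"
  using k
proof (induction n)
  case 0
  have "red 0 = \<zero>\<^bsub>res\<^esub>"
    using red_zero_iff[of 0] zero_less_Pinf by simp
  then show ?case
    using ring.eval.simps(1)[OF ring_res] zero_less_Pinf by simp
next
  case (Suc n)
  have pow: "f ^ m \<in> F \<and> 0 \<le> w (f ^ m) \<and> red f [^]\<^bsub>res\<^esub> m = red (f ^ m)" for m
  proof (induction m)
    case 0
    then show ?case
      using ring_hom_memE(4)[OF red_hom] by simp
  next
    case (Suc m)
    then show ?case
      using f add_mono[of 0 "w f" 0 "w (f ^ m)"] red_simps(1)[of "f ^ m" f]
      by (simp add: v_mult mult_mem mult.commute)
  qed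
  let ?s = "\<Sum>i<n. k i * f ^ i"
  have IH: "?s \<in> F" "0 \<le> w ?s" "ring.eval res (map (\<lambda>i. red (k i)) (rev [0..<n])) (red f) = red ?s"
    using Suc by auto
  have kn: "k n \<in> F" "0 \<le> w (k n)"
    using Suc.prems[of n] by auto
  have t: "k n * f ^ n \<in> F" "0 \<le> w (k n * f ^ n)"
    using kn pow[of n] add_mono[of 0 "w (k n)" 0 "w (f ^ n)"] by (auto simp: v_mult mult_mem)
  have "min (w ?s) (w (k n * f ^ n)) \<le> w (?s + k n * f ^ n)"
    using IH t by (intro v_add)
  then have "0 \<le> w (?s + k n * f ^ n)"
    using IH(2) t(2) by (auto simp: min_def split: if_splits)
  moreover have "ring.eval res (map (\<lambda>i. red (k i)) (rev [0..<Suc n])) (red f)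
      = red (k n) \<otimes>\<^bsub>res\<^esub> red (f ^ n) \<oplus>\<^bsub>res\<^esub> red ?s"
    using ring.eval.simps(2)[OF ring_res] IH(3) pow[of n] by simp
  moreover have "red (k n) \<otimes>\<^bsub>res\<^esub> red (f ^ n) \<oplus>\<^bsub>res\<^esub> red ?s = red (?s + k n * f ^ n)"
    using red_simps(1)[OF kn, of "f ^ n"] pow[of n] red_simps(2)[OF t IH(1,2)] by (simp add: add.commute)
  ultimately show ?case
    using IH t by (simp add: add_mem)
qed

text \<open>The value 0 of \<open>k n\<close> makes the reduced leading coefficient nonzero, which
  turns the reduced list into a genuine nonzero polynomial that vanishes at the residue of
  f.\<close>

lemma residue_not_transcendental:
  assumes f: "f \<in> F" "0 \<le> w f" and k: "\<And>i. i \<le> n \<Longrightarrow> k i \<in> F \<and> 0 \<le> w (k i) \<and> red (k i) \<in> M"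
    and kn: "w (k n) = 0" and sum: "0 < w (\<Sum>i\<le>n. k i * f ^ i)"
  shows "\<not> ring.transcendental res M (red f)"
proof -
  let ?q = "map (\<lambda>i. red (k i)) (rev [0..<Suc n])"
  have lt: "i < Suc n \<Longrightarrow> k i \<in> F \<and> 0 \<le> w (k i)" for i
    using k[of i] by simp
  note ev = eval_red[where k = k and n = "Suc n", OF f lt]
  have "ring.eval res ?q (red f) = \<zero>\<^bsub>res\<^esub>"
    using ev red_zero_iff[of "\<Sum>i<Suc n. k i * f ^ i"] sum by (simp add: lessThan_Suc_atMost del: sum.lessThan_Suc)
  moreover have "?q \<noteq> []"
    by simp
  moreover have "red (k n) \<noteq> \<zero>\<^bsub>res\<^esub>"
    using red_zero_iff[of "k n"] k[of n] kn by simp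
  then have "?q \<in> carrier (M [X]\<^bsub>res\<^esub>)"
    using k by (auto simp: univ_poly_def polynomial_def)
  ultimately show ?thesis
    using ring.algebraicI[OF ring_res, of ?q M "red f"] by (simp add: over_def)
qed

end

section \<open>Pairs of definition\<close>

lemma valued_ring_cong:
  assumes "valued_ring S v" "\<And>x. x \<in> S \<Longrightarrow> v' x = v x"
  shows "valued_ring S v'"
proof -
  interpret valued_ring S v by fact
  show ?thesis
    by (intro valued_ring.intro)
       (simp_all add: assms(2) S_zero S_one S_add S_uminus S_mult v_neq_Minf v_eq_Pinf_iff v_mult v_add)
qed

lemma (in valued_field) valued_subfield:
  assumes "field_set B" "B \<subseteq> F"
  shows "valued_field B w"
proof -
  interpret B: field_set B by fact
  show ?thesis
    by (intro valued_field.intro assms(1) valued_subring B.add_mem B.uminus_mem B.mult_mem assms(2)) simp_all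
qed

lemma (in valued_field) value_group_closed:
  "0 \<in> value_group w F"
  "x \<in> value_group w F \<Longrightarrow> y \<in> value_group w F \<Longrightarrow> x + y \<in> value_group w F"
  "x \<in> value_group w F \<Longrightarrow> - x \<in> value_group w F"
proof -
  show "0 \<in> value_group w F"
    unfolding value_group_def using v_one by (intro CollectI bexI[of _ 1]) (simp_all add: zero_extended_def)
  show "x + y \<in> value_group w F" if xy: "x \<in> value_group w F" "y \<in> value_group w F"
  proof -
    obtain r s where "r \<in> F" "s \<in> F" "w r = Fin x" "w s = Fin y"
      using xy by (auto simp: value_group_def)
    then show ?thesis
      unfolding value_group_def by (intro CollectI bexI[of _ "r * s"] mult_mem) (simp_all add: v_mult)
  qed
  show "- x \<in> value_group w F" if x: "x \<in> value_group w F"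
  proof -
    obtain r where "r \<in> F" "w r = Fin x"
      using x by (auto simp: value_group_def)
    then show ?thesis
      unfolding value_group_def using v_inverse by (intro CollectI bexI[of _ "inverse r"] inverse_mem)
  qed
qed

locale ratfun_valued = base: field_set K + valued_field "ratfuns (alg_cl K)" v
  for K :: "'c::alg_closed_field set" and v :: "'c poly fract \<Rightarrow> 'g::linordered_ab_group_add extended"
begin

sublocale cl: alg_closed_set "alg_cl K"
  by (rule alg_closed_alg_cl) (rule base.field_set_axioms)

lemma key_valuation: "key_valuation K v"
proof (intro key_valuation.intro poly_valued.intro base.field_set_axioms cl.alg_closed_set_axioms)
  show "valued_ring (polys_over (alg_cl K)) (\<lambda>p. v (to_fract p))"
    by (intro valued_ring.intro)
       (simp_all add: cl.polys_over_add cl.polys_over_uminus cl.polys_over_mult cl.to_fract_mem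
          v_neq_Minf v_eq_Pinf_iff v_mult v_add)
qed

sublocale key: key_valuation K v
  by (rule key_valuation)

lemma of_const_V: "(\<lambda>c. v (of_const c)) = (\<lambda>c. v (to_fract [:c:]))"
  by (simp add: of_const_def)

lemma const_field: "field_set (of_const ` alg_cl K)" "of_const ` alg_cl K \<subseteq> ratfuns (alg_cl K)"
  using field_set_of_const[OF cl.field_set_axioms] cl.of_const_mem by auto

lemma pair_of_definition_max:
  assumes a: "a \<in> alg_cl K"
    and max: "\<And>b. b \<in> alg_cl K \<Longrightarrow> v (to_fract [:- b, 1:]) \<le> v (to_fract [:- a, 1:])"
  shows "\<exists>ag. pair_of_definition K v ag"
proof -
  obtain \<gamma> where \<gamma>: "v (to_fract [:- a, 1:]) = Fin \<gamma>"
    using key.linear_finite[OF a] by blast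
  have G: "gauss_poly key.w a \<gamma> p = v (to_fract p)" if p: "p \<in> polys_over (alg_cl K)" for p
  proof (cases "p = 0")
    case False
    have "v (to_fract [:- b, 1:]) \<le> Fin \<gamma>" if "poly p b = 0" for b
      using max[OF cl.root_mem[OF p False that]] \<gamma> by simp
    then show ?thesis
      using key.gauss_eq_V_iff[OF a \<gamma> p False] by blast
  qed simp
  have "v r = gauss_val (alg_cl K) key.w a \<gamma> r" if r: "r \<in> ratfuns (alg_cl K)" for r
  proof -
    obtain p q where pq: "p \<in> polys_over (alg_cl K)" "q \<in> polys_over (alg_cl K)" "q \<noteq> 0"
        "r = Fraction_Field.Fract p q"
      using r by (auto simp: ratfuns_def)
    have "r = to_fract p * inverse (to_fract q)"
      using pq by (simp add: to_fract_def)
    moreover obtain h where h: "v (to_fract q) = Fin h"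
      using key.v_finite pq by blast
    ultimately have "v r = v (to_fract p) + Fin (- h)"
      using pq by (simp add: v_mult v_inverse[OF _ h] cl.to_fract_mem inverse_mem)
    also have "\<dots> = v (to_fract p) - v (to_fract q)"
      using h by (simp add: minus_extended_def)
    also have "\<dots> = gauss_val (alg_cl K) key.w a \<gamma> r"
      using key.const.gauss_val_Fract[OF a pq(1-3)] G pq by simp
    finally show ?thesis .
  qed
  moreover have "\<gamma> \<in> value_group v (ratfuns (alg_cl K))"
    unfolding value_group_def using \<gamma> a by (auto intro!: bexI[of _ "to_fract [:- a, 1:]"] cl.to_fract_mem)
  ultimately show ?thesis
    unfolding pair_of_definition_def of_const_V using a by (intro exI[of _ "(a, \<gamma>)"]) simp
qed

lemma pair_of_definition_value:
  assumes "pair_of_definition K v (a, \<gamma>)"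
  shows "a \<in> alg_cl K" "p \<in> polys_over (alg_cl K) \<Longrightarrow> gauss_poly key.w a \<gamma> p = v (to_fract p)"
proof -
  show a: "a \<in> alg_cl K"
    using assms by (simp add: pair_of_definition_def)
  assume p: "p \<in> polys_over (alg_cl K)"
  have "v (to_fract p) = gauss_val (alg_cl K) key.w a \<gamma> (to_fract p)"
    using assms cl.to_fract_mem[OF p] unfolding pair_of_definition_def of_const_V by simp
  then show "gauss_poly key.w a \<gamma> p = v (to_fract p)"
    using key.const.gauss_val_to_fract[OF a p] by simp
qed

text \<open>If v (X - b) exceeds v (X - a), then X - a differs from the constant b - a by X - b,
  hence is near it. Products and inverses inherit this.\<close>

lemma near_all:
  assumes no_max: "\<And>a. a \<in> alg_cl K \<Longrightarrow> \<exists>b\<in>alg_cl K. v (to_fract [:- a, 1:]) < v (to_fract [:- b, 1:])"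
    and r: "r \<in> ratfuns (alg_cl K)" "r \<noteq> 0"
  shows "near (of_const ` alg_cl K) r"
proof -
  have poly: "near (of_const ` alg_cl K) (to_fract p)" if "p \<in> polys_over (alg_cl K)" "p \<noteq> 0" for p
    using that
  proof (induction p rule: cl.factor_induct)
    case (const c)
    then have "v (to_fract [:c:]) < \<infinity>"
      using key.w_finite[of c] by auto
    then show ?case
      unfolding near_def using const by (intro bexI[of _ "of_const c"]) (auto simp: of_const_def)
  next
    case (factor a q)
    obtain b where b: "b \<in> alg_cl K" "v (to_fract [:- a, 1:]) < v (to_fract [:- b, 1:])"
      using no_max factor by blast
    have "to_fract [:- a, 1:] - of_const (b - a) = to_fract [:- b, 1:]"
      unfolding of_const_def to_fract_diff[symmetric] by simp
    then have "near (of_const ` alg_cl K) (to_fract [:- a, 1:])"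
      unfolding near_def using b factor by (intro bexI[of _ "of_const (b - a)"]) (auto intro: cl.diff_mem)
    then show ?case
      unfolding to_fract_mult using factor
      by (intro near_mult const_field) (auto intro!: cl.to_fract_mem)
  qed
  obtain p q where pq: "p \<in> polys_over (alg_cl K)" "q \<in> polys_over (alg_cl K)" "q \<noteq> 0"
      "r = to_fract p * inverse (to_fract q)"
    using r by (auto simp: cl.mem_ratfuns_iff)
  then have "p \<noteq> 0"
    using r by auto
  then show ?thesis
    unfolding pq(4) using pq(1-3)
    by (intro near_mult near_inverse const_field poly) (auto intro!: cl.to_fract_mem inverse_mem)
qed

text \<open>Every value of K(X) is then the value of an algebraic constant, and such values are
  torsion modulo vK.\<close>

lemma not_value_transcendental:
  assumes near: "\<And>r. r \<in> ratfuns K \<Longrightarrow> r \<noteq> 0 \<Longrightarrow> near (of_const ` alg_cl K) r"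
  shows "\<not> value_transcendental K v"
proof
  assume *: "value_transcendental K v"
  have sub: "ratfuns K \<subseteq> ratfuns (alg_cl K)"
    by (rule ratfuns_mono[OF base.subset_alg_cl])
  have ratK: "valued_field (ratfuns K) v"
    by (rule valued_subfield[OF field_set_ratfuns[OF base.field_set_axioms] sub])
  have constK: "valued_field (of_const ` K) v"
    by (rule valued_subfield[OF field_set_of_const[OF base.field_set_axioms]])
       (use base.of_const_mem sub in auto)
  have "value_group v (of_const ` K) \<subseteq> value_group v (ratfuns K)"
    unfolding value_group_def using base.of_const_mem by auto
  then obtain x where x: "x \<in> value_group v (ratfuns K)"
      "\<And>n. n \<noteq> 0 \<Longrightarrow> nsmul n x \<notin> value_group v (of_const ` K)"
    using rational_rank_one_imp_not_torsion[OF valued_field.value_group_closed[OF ratK] _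
        valued_field.value_group_closed[OF constK]] *
    unfolding value_transcendental_def by blast
  then obtain r where r: "r \<in> ratfuns K" "v r = Fin x"
    by (auto simp: value_group_def)
  then have "r \<noteq> 0"
    by auto
  then obtain c where c: "c \<in> alg_cl K" "v r < v (r - of_const c)"
    using near[OF r(1)] by (auto simp: near_def)
  have "v (of_const c) = Fin x"
    using near_value[of r "of_const c"] r c sub cl.of_const_mem by auto
  then obtain n d where nd: "n \<noteq> 0" "d \<in> K" "v (of_const d) = Fin (nsmul n x)"
    using key.const.algebraic_torsion[OF base.field_set_axioms base.subset_alg_cl c(1) c(1), of x]
    unfolding of_const_def by blast
  then have "nsmul n x \<in> value_group v (of_const ` K)"
    by (auto simp: value_group_def)
  with x(2)[OF nd(1)] show False
    by contradiction
qed

text \<open>A transcendence basis would consist of one residue of some f. If f has positive value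
  this residue is 0; otherwise it is the residue of a constant algebraic over K, and therefore
  algebraic as well.\<close>

lemma not_residue_transcendental:
  assumes near: "\<And>r. r \<in> ratfuns K \<Longrightarrow> r \<noteq> 0 \<Longrightarrow> near (of_const ` alg_cl K) r"
  shows "\<not> residue_transcendental K v"
proof
  assume *: "residue_transcendental K v"
  have sub: "ratfuns K \<subseteq> ratfuns (alg_cl K)"
    by (rule ratfuns_mono[OF base.subset_alg_cl])
  have "valued_field (ratfuns K) v"
    by (rule valued_subfield[OF field_set_ratfuns[OF base.field_set_axioms] sub])
  then interpret rat: valuation_residues "ratfuns K" v
    by (rule valuation_residues.intro)
  let ?M = "\<lambda>B. generate_field rat.res (residues (field_on (ratfuns K)) v (of_const ` K) \<union> B)"
  obtain B where B: "B \<subseteq> carrier rat.res" "card B = 1"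
      "\<forall>b\<in>B. ring.transcendental rat.res (?M (B - {b})) b"
    using * unfolding residue_transcendental_def has_trdeg_def by blast
  obtain b where "B = {b}"
    using B(2) by (rule card_1_singletonE)
  with B have b: "b \<in> carrier rat.res" "ring.transcendental rat.res (?M {}) b"
    by auto
  have "b \<in> rat.red ` carrier rat.val_ring"
    using b(1) by (auto simp: residue_field_def FactRing_def A_RCOSETS_def')
  then obtain f where f: "f \<in> ratfuns K" "0 \<le> v f" "b = rat.red f"
    by auto
  have M: "rat.red (of_const k) \<in> ?M {}" if "k \<in> K" "0 \<le> v (of_const k)" for k
    using that by (intro generate_field.incl) (auto simp: residues_def)
  have "\<exists>n k. (\<forall>i\<le>n. k i \<in> of_const ` K \<and> 0 \<le> v (k i)) \<and> v (k n) = 0 \<and> 0 < v (\<Sum>i\<le>n. k i * f ^ i)"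
  proof (cases "0 < v f")
    case True
    \<comment> \<open>The residue is a root of the polynomial X.\<close>
    define k :: "nat \<Rightarrow> 'c poly fract" where "k i = (if i = 0 then 0 else 1)" for i
    have "(\<Sum>i\<le>1. k i * f ^ i) = f"
      by (simp add: k_def)
    moreover have "k i \<in> of_const ` K" "0 \<le> v (k i)" "v (k 1) = 0" for i
      using field_set.zero_mem[OF field_set_of_const[OF base.field_set_axioms]]
        field_set.one_mem[OF field_set_of_const[OF base.field_set_axioms]]
      by (auto simp: k_def zero_extended_def[symmetric] rat.zero_less_Pinf)
    ultimately show ?thesis
      using True by (intro exI[of _ 1] exI[of _ k]) simp
  next
    case False
    then have f0: "v f = 0" "f \<noteq> 0"
      using f(2) rat.zero_less_Pinf by auto
    \<comment> \<open>As f has value 0, being near c means having the same residue as c.\<close>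
    then obtain c where c: "c \<in> alg_cl K" "v f < v (f - of_const c)"
      using near[OF f(1)] by (auto simp: near_def)
    obtain p where p: "p \<in> polys_over K" "p \<noteq> 0" "poly p c = 0"
      using c(1) by (auto simp: alg_cl_def)
    have "(\<Sum>i\<le>Polynomial.degree p. of_const (Polynomial.coeff p i) * of_const c ^ i) = of_const (poly p c)"
      by (simp add: poly_altdef of_const_sum of_const_power of_const_simps)
    also have "\<dots> = 0"
      by (simp add: p(3) of_const_simps)
    finally show ?thesis
      using f f0 c p sub base.of_const_mem
      by (intro residue_relation[where c = "of_const c" and p = "\<lambda>i. of_const (Polynomial.coeff p i)"
            and N = "Polynomial.degree p"] field_set_of_const base.field_set_axioms)
         (auto simp: of_const_simps intro: cl.of_const_mem base.coeff_mem)
  qed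
  then obtain n k where k: "\<And>i. i \<le> n \<Longrightarrow> k i \<in> of_const ` K \<and> 0 \<le> v (k i)"
      and kn: "v (k n) = 0" and sum: "0 < v (\<Sum>i\<le>n. k i * f ^ i)"
    by blast
  have k': "k i \<in> ratfuns K \<and> 0 \<le> v (k i) \<and> rat.red (k i) \<in> ?M {}" if "i \<le> n" for i
    using k[OF that] M base.of_const_mem by auto
  have "\<not> ring.transcendental rat.res (?M {}) (rat.red f)"
    using f(1,2) k' kn sum by (rule rat.residue_not_transcendental)
  with b(2) f(3) show False
    by simp
qed

lemma pair_of_definition_exists:
  assumes "valuation_transcendental K v"
  shows "\<exists>ag. pair_of_definition K v ag"
proof (rule ccontr)
  assume no_pair: "\<not> (\<exists>ag. pair_of_definition K v ag)"
  have no_max: "\<exists>b\<in>alg_cl K. v (to_fract [:- a, 1:]) < v (to_fract [:- b, 1:])" if "a \<in> alg_cl K" for a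
    using pair_of_definition_max[OF that] no_pair by (meson not_le)
  have "near (of_const ` alg_cl K) r" if "r \<in> ratfuns K" "r \<noteq> 0" for r
    using near_all[OF no_max] that ratfuns_mono[OF base.subset_alg_cl] by blast
  then show False
    using not_value_transcendental not_residue_transcendental assms
    unfolding valuation_transcendental_def by blast
qed

text \<open>Cofinality concerns values of K(X), but \<gamma> is only known to be a value over the
  algebraic closure. A nonzero p over K with root a factors as q (X - a), so \<gamma> is the value
  of p minus the value h of q. The former is bounded by hypothesis; for -h a bound in vK has to be
  found separately.\<close>

lemma pair_of_definition_cofinal:
  assumes pair: "pair_of_definition K v (a, \<gamma>)"
    and cofinal: "\<And>x. x \<in> value_group v (ratfuns K) \<Longrightarrow> \<exists>\<beta>\<in>value_group v (of_const ` K). x \<le> \<beta>"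
  shows "\<exists>e\<in>K. e \<noteq> 0 \<and> Fin \<gamma> \<le> v (of_const e) \<and> 0 \<le> v (of_const e)"
proof (cases "0 \<le> \<gamma>")
  case False
  then have "Fin \<gamma> \<le> 0"
    by (simp add: zero_extended_def)
  then show ?thesis
    by (intro bexI[of _ 1]) (simp_all add: of_const_simps)
next
  case True
  have a: "a \<in> alg_cl K"
    and G: "\<And>p. p \<in> polys_over (alg_cl K) \<Longrightarrow> gauss_poly key.w a \<gamma> p = v (to_fract p)"
    using pair_of_definition_value[OF pair] by auto
  obtain p where p: "p \<in> polys_over K" "p \<noteq> 0" "poly p a = 0"
    using a by (auto simp: alg_cl_def)
  have p_cl: "p \<in> polys_over (alg_cl K)"
    using p(1) by (rule key.polys_over_alg_cl)
  obtain q r where qr: "q \<in> polys_over (alg_cl K)" "p = q * [:- a, 1:] + r"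
      "Polynomial.degree r < Polynomial.degree [:- a, 1:]"
    using cl.division_mem[of "[:- a, 1:]" p] p_cl a cl.polys_over_linear by auto
  obtain c where "r = [:c:]"
    using qr(3) by (auto elim: degree_eq_zeroE)
  with qr p(3) have p_eq: "p = q * [:- a, 1:]"
    by simp
  then have q0: "q \<noteq> 0"
    using p(2) by auto
  obtain h where h: "v (to_fract q) = Fin h"
    using key.v_finite[OF qr(1) q0] by blast
  have "v (to_fract [:- a, 1:]) = Fin \<gamma>"
    using G[OF key.linear_mem[OF a]] by (simp add: key.const.gauss_poly_linear)
  then have vp: "v (to_fract p) = Fin (h + \<gamma>)"
    using h key.v_mult[OF qr(1) key.linear_mem[OF a]] p_eq by simp
  have "h + \<gamma> \<in> value_group v (ratfuns K)"
    unfolding value_group_def using vp base.to_fract_mem[OF p(1)] by blast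
  then obtain d \<beta> where d: "d \<in> K" "v (of_const d) = Fin \<beta>" "h + \<gamma> \<le> \<beta>"
    using cofinal by (fastforce simp: value_group_def)
  \<comment> \<open>The term at which the Gauss value of q is attained gives h = w b + i \<gamma>.
    As \<gamma> is nonnegative here, -h is at most the value of \<open>inverse b\<close>, and b is
    algebraic over K.\<close>
  obtain i where i: "gauss_poly key.w a \<gamma> q = key.const.gauss_term a \<gamma> q i"
    using key.const.gauss_poly_attained by blast
  define b where "b = Polynomial.coeff (pcompose q [:a, 1:]) i"
  have b: "b \<in> alg_cl K"
    unfolding b_def using key.const.pcompose_shift_mem[OF a qr(1)] by (rule cl.coeff_mem)
  have "Fin h = key.w b + Fin (nsmul i \<gamma>)"
    using i G[OF qr(1)] h by (simp add: key.const.gauss_term_def b_def)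
  then obtain g where g: "key.w b = Fin g" "h = g + nsmul i \<gamma>"
    by (cases "key.w b") auto
  have "0 \<le> nsmul i \<gamma>"
    using nsmul_ge_self[OF True, of i] True by (cases "i = 0") auto
  then have "g \<le> h"
    using g(2) by simp
  have "key.w (inverse b) = Fin (- g)"
    by (rule key.const.v_inverse[OF b g(1)])
  then obtain e where e: "e \<in> K" "e \<noteq> 0" "Fin (- g) \<le> v (of_const e)"
    using key.const.algebraic_cofinal[OF base.field_set_axioms base.subset_alg_cl]
      cl.inverse_mem[OF b] unfolding of_const_def by blast
  obtain \<epsilon> where \<epsilon>: "v (of_const e) = Fin \<epsilon>"
    using key.w_finite[of e] e base.subset_alg_cl unfolding of_const_def by blast
  have "- g \<le> \<epsilon>"
    using e(3) \<epsilon> by simp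
  then have "\<gamma> \<le> \<beta> + \<epsilon>"
  proof -
    have "\<gamma> \<le> (h + \<gamma>) + (- g)"
      using \<open>g \<le> h\<close> by (simp add: algebra_simps)
    also have "\<dots> \<le> \<beta> + \<epsilon>"
      using d(3) \<open>- g \<le> \<epsilon>\<close> by (rule add_mono)
    finally show ?thesis .
  qed
  moreover have "v (of_const (d * e)) = Fin (\<beta> + \<epsilon>)"
    using v_mult[OF cl.of_const_mem[OF subsetD[OF base.subset_alg_cl d(1)]]
        cl.of_const_mem[OF subsetD[OF base.subset_alg_cl e(1)]]] d(2) \<epsilon>
    by (simp add: of_const_simps)
  moreover have "d * e \<noteq> 0"
    using d e by (auto simp: of_const_simps)
  ultimately show ?thesis
    using True d(1) e(1) by (intro bexI[of _ "d * e"] base.mult_mem) (auto simp: zero_extended_def)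
qed

end

section \<open>Passing to the completion\<close>

text \<open>The value of p at b is that of the leading coefficient times all differences b - b'. It
  serves in contrapositive form: a monic p of degree n with value beyond n \<gamma> at b has a root
  closer to b than \<gamma>.\<close>

lemma root_near:
  assumes "alg_closed_set E" "valued_field E w"
    and b: "b \<in> E" and p: "p \<in> polys_over E" "p \<noteq> 0"
    and far: "\<And>b'. poly p b' = 0 \<Longrightarrow> w (b - b') \<le> Fin \<gamma>"
  shows "w (poly p b) \<le> w (Polynomial.lead_coeff p) + Fin (nsmul (Polynomial.degree p) \<gamma>)"
proof -
  interpret alg_closed_set E by fact
  interpret valued_field E w by fact
  show ?thesis
    using p far
  proof (induction p rule: factor_induct)
    case (const c)
    then show ?case
      by (cases "w c") auto
  next
    case (factor b' q)
    have deg: "Polynomial.degree ([:- b', 1:] * q) = Suc (Polynomial.degree q)"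
      using factor(3) by (subst degree_mult_eq) auto
    have lead: "Polynomial.lead_coeff ([:- b', 1:] * q) = Polynomial.lead_coeff q"
      by (simp only: lead_coeff_mult) simp
    have "w (b - b') \<le> Fin \<gamma>"
      by (rule factor.prems) simp
    moreover have "w (poly q b) \<le> w (Polynomial.lead_coeff q) + Fin (nsmul (Polynomial.degree q) \<gamma>)"
      using factor.prems by (intro factor.IH) simp
    moreover have "poly ([:- b', 1:] * q) b = (b - b') * poly q b"
      by (simp add: algebra_simps)
    moreover have "w ((b - b') * poly q b) = w (b - b') + w (poly q b)"
      using b factor by (intro v_mult diff_mem poly_mem)
    ultimately have "w (poly ([:- b', 1:] * q) b) \<le> Fin \<gamma> + (w (Polynomial.lead_coeff q) + Fin (nsmul (Polynomial.degree q) \<gamma>))"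
      by (simp only: add_mono)
    then show ?case
      unfolding lead unfolding deg by (simp add: ac_simps plus_extended.simps(1)[symmetric] del: plus_extended.simps)
  qed
qed

text \<open>Since b is a root of f, the value of g at b comes from the coefficient errors multiplied
  by powers of b. If b has negative value these powers magnify the errors, so the coefficients must
  be approximated beyond n \<gamma> by a margin that depends on b.\<close>

lemma monic_approximation:
  fixes K L E :: "'a::alg_closed_field set"
  assumes "field_set K" "field_set L" "K \<subseteq> L" and w: "valued_field E w" and LE: "L \<subseteq> E"
    and dense: "\<And>x g. x \<in> L \<Longrightarrow> g \<in> value_group w L \<Longrightarrow> \<exists>y\<in>K. Fin g < w (x - y)"
    and f: "f \<in> polys_over L" "Polynomial.lead_coeff f = 1"
    and b: "b \<in> E" "b \<in> alg_cl L" "poly f b = 0"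
    and e: "e \<in> L" "e \<noteq> 0" "Fin \<gamma> \<le> w e" "0 \<le> w e"
  shows "\<exists>g\<in>polys_over K. Polynomial.lead_coeff g = 1 \<and> Polynomial.degree g = Polynomial.degree f \<and>
    Fin (nsmul (Polynomial.degree f) \<gamma>) < w (poly g b)"
proof -
  interpret K: field_set K by fact
  interpret L: field_set L by fact
  interpret valued_field E w by fact
  define n where "n = Polynomial.degree f"
  \<comment> \<open>A denominator for b. It exists because the inverse of b is algebraic over L, so
    its value is dominated by a value of L.\<close>
  have "\<exists>d\<in>L. d \<noteq> 0 \<and> 0 \<le> w d \<and> 0 \<le> w (b * d)"
  proof (cases "0 \<le> w b")
    case True
    then show ?thesis
      by (intro bexI[of _ 1]) auto
  next
    case False
    then have "b \<noteq> 0"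
      using v_zero by (auto simp: zero_extended_def)
    then obtain g where g: "w b = Fin g"
      using v_finite b(1) by blast
    have inv: "inverse b \<in> alg_cl L"
      using alg_closed_alg_cl[OF L.field_set_axioms] b(2)
      by (simp add: alg_closed_set_def field_set.inverse_mem)
    obtain d where d: "d \<in> L" "d \<noteq> 0" "Fin (- g) \<le> w d"
      using algebraic_cofinal[OF L.field_set_axioms LE inverse_mem[OF b(1)] inv v_inverse[OF b(1) g]] by blast
    obtain h where h: "w d = Fin h"
      using v_finite d(1,2) LE by blast
    have "0 \<le> - g" "- g \<le> h"
      using False d(3) unfolding g h by (auto simp: zero_extended_def)
    moreover have "0 \<le> g + h"
      using add_left_mono[OF \<open>- g \<le> h\<close>, of g] by simp
    moreover have "0 \<le> h"
      using \<open>0 \<le> - g\<close> \<open>- g \<le> h\<close> by (rule order_trans)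
    moreover have "w (b * d) = Fin (g + h)"
      using d(1) g h b(1) LE by (simp add: v_mult subset_iff)
    ultimately show ?thesis
      using d(1,2) h by (intro bexI[of _ d]) (simp_all add: zero_extended_def)
  qed
  then obtain d where d: "d \<in> L" "d \<noteq> 0" "0 \<le> w d" "0 \<le> w (b * d)"
    by (elim bexE conjE)
  have eE: "e \<in> E" and dE: "d \<in> E"
    using e d LE by auto
  \<comment> \<open>The factor \<open>e ^ n\<close> accounts for n \<gamma>, and
    \<open>d ^ n\<close> pays for the powers of b. Their product lies in L, so density applies at
    its value.\<close>
  have "e ^ n * d ^ n \<noteq> 0" "e ^ n * d ^ n \<in> L"
    using e d by (auto intro: L.mult_mem L.power_mem)
  then obtain t where t: "w (e ^ n * d ^ n) = Fin t"
    using v_finite LE by blast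
  have "t \<in> value_group w L"
    unfolding value_group_def using t \<open>e ^ n * d ^ n \<in> L\<close> by blast
  then have "\<forall>i. \<exists>y\<in>K. Fin t < w (Polynomial.coeff f i - y)"
    using dense L.coeff_mem[OF f(1)] by blast
  then have "\<exists>c. \<forall>i. c i \<in> K \<and> Fin t < w (Polynomial.coeff f i - c i)"
    unfolding Bex_def by (rule choice)
  then obtain c where c': "\<forall>i. c i \<in> K \<and> Fin t < w (Polynomial.coeff f i - c i)"
    by (elim exE)
  then have c: "c i \<in> K" "Fin t < w (Polynomial.coeff f i - c i)" for i
    by simp_all
  define r where "r = (\<Sum>i<n. Polynomial.monom (c i) i)"
  \<comment> \<open>The leading coefficient stays exactly 1: the degree is preserved and the error
    has no term of index n.\<close>
  define g where "g = Polynomial.monom 1 n + r"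
  have coeff_r: "Polynomial.coeff r i = (if i < n then c i else 0)" for i
    by (auto simp: r_def coeff_sum coeff_monom)
  have coeff_g: "Polynomial.coeff g i = (if i < n then c i else if i = n then 1 else 0)" for i
    by (auto simp: g_def coeff_r)
  have deg_g: "Polynomial.degree g = n"
    by (rule antisym[OF degree_le le_degree]) (auto simp: coeff_g)
  have g: "g \<in> polys_over K"
    using c(1) by (auto simp: polys_over_def coeff_g)
  have wen: "Fin (nsmul n \<gamma>) \<le> w (e ^ n)"
  proof -
    obtain \<epsilon> where \<epsilon>: "w e = Fin \<epsilon>"
      using v_finite[OF eE e(2)] by blast
    have "nsmul n \<gamma> \<le> nsmul n \<epsilon>"
      using e(3) \<epsilon> by (induction n) (auto intro: add_mono)
    then show ?thesis
      using v_power[OF eE, of n] \<epsilon> by simp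
  qed
  have small: "Fin (nsmul n \<gamma>) < w ((c i - Polynomial.coeff f i) * b ^ i)" if i: "i < n" for i
  proof (cases "b ^ i = 0")
    case True
    show ?thesis
      unfolding True by simp
  next
    case False
    have mem: "c i - Polynomial.coeff f i \<in> E" "Polynomial.coeff f i - c i \<in> E" "b ^ i \<in> E" "e ^ n * d ^ n \<in> E"
      using c(1)[of i] L.coeff_mem[OF f(1)] \<open>K \<subseteq> L\<close> LE b(1) eE dE
      by (auto intro!: diff_mem power_mem mult_mem)
    have "w (e ^ n * d ^ n) < w (c i - Polynomial.coeff f i)"
      using c(2)[of i] t v_uminus[OF mem(2)] by simp
    then have lt: "w ((e ^ n * d ^ n) * b ^ i) < w ((c i - Polynomial.coeff f i) * b ^ i)"
      using mem False by (intro v_mult_strict)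
    \<comment> \<open>Each of the i factors b is paired with a factor d; the other factors d have
      nonnegative value.\<close>
    have "d ^ n = d ^ i * d ^ (n - i)"
      using i by (simp add: power_add[symmetric])
    then have eq: "(e ^ n * d ^ n) * b ^ i = e ^ n * ((b * d) ^ i * d ^ (n - i))"
      by (simp add: power_mult_distrib)
    have ge: "0 \<le> w ((b * d) ^ i)" "0 \<le> w (d ^ (n - i))"
      using b dE d by (auto intro!: v_power_nonneg mult_mem)
    have mems: "(b * d) ^ i \<in> E" "d ^ (n - i) \<in> E" "e ^ n \<in> E"
      using b dE eE by (auto intro!: power_mem mult_mem)
    have "0 + 0 \<le> w ((b * d) ^ i) + w (d ^ (n - i))"
      using ge by (rule add_mono)
    then have "w (e ^ n) + 0 \<le> w (e ^ n) + w ((b * d) ^ i * d ^ (n - i))"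
      using mems by (intro add_left_mono) (simp add: v_mult)
    also have "\<dots> = w ((e ^ n * d ^ n) * b ^ i)"
      unfolding eq using mems by (simp add: v_mult mult_mem)
    finally have "w (e ^ n) \<le> w ((e ^ n * d ^ n) * b ^ i)"
      by simp
    with wen lt show ?thesis
      by (meson order_le_less_trans order_trans)
  qed
  have "poly g b = poly g b - poly f b"
    using b(3) by simp
  also have "\<dots> = (\<Sum>i\<le>n. (Polynomial.coeff g i - Polynomial.coeff f i) * b ^ i)"
    unfolding poly_altdef deg_g n_def[symmetric] by (simp add: sum_subtractf left_diff_distrib)
  also have "\<dots> = (\<Sum>i<n. (Polynomial.coeff g i - Polynomial.coeff f i) * b ^ i)"
    using f(2) by (simp add: lessThan_Suc_atMost[symmetric] coeff_g n_def)
  also have "\<dots> = (\<Sum>i<n. (c i - Polynomial.coeff f i) * b ^ i)"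
    by (intro sum.cong) (auto simp: coeff_g)
  finally have gb: "poly g b = (\<Sum>i<n. (c i - Polynomial.coeff f i) * b ^ i)" .
  have "Fin (nsmul n \<gamma>) < w (\<Sum>i<n. (c i - Polynomial.coeff f i) * b ^ i)"
  proof (rule v_sum_gt, intro conjI small)
    fix i
    show "(c i - Polynomial.coeff f i) * b ^ i \<in> E"
      using c(1)[of i] L.coeff_mem[OF f(1)] \<open>K \<subseteq> L\<close> LE b(1) by (auto intro!: diff_mem power_mem mult_mem)
  qed auto
  then have "Fin (nsmul n \<gamma>) < w (poly g b)"
    unfolding gb .
  then show ?thesis
    using g deg_g by (intro bexI[of _ g]) (auto simp: coeff_g n_def)
qed

lemma field_on_minus:
  assumes "field_set L" "x \<in> L" "y \<in> L"
  shows "x \<ominus>\<^bsub>field_on L\<^esub> y = x - y"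
proof -
  interpret L: field_set L by fact
  have "ring (field_on L)"
    using assms(1) field_set_iff_subfield subfieldE(1) ring.subring_is_ring[OF ring_from_type_algebra] by blast
  then have "\<ominus>\<^bsub>field_on L\<^esub> y = - y"
    using assms by (intro abelian_group.minus_equality ring.is_abelian_group) (auto simp: type_algebra_simps L.uminus_mem)
  then show ?thesis
    by (simp add: a_minus_def type_algebra_simps)
qed

theorem theorem3p1:
  fixes K L :: "'c::alg_closed_field set"
    and v :: "'c poly fract \<Rightarrow> 'g::linordered_ab_group_add extended"
    and w :: "'c \<Rightarrow> 'g extended"
    and \<Lambda> :: "'c poly set"
  assumes "subfield K ring_of_type_algebra"
    and "krull_valuation (field_on (ratfuns (alg_cl K))) v"
    and "valuation_transcendental K v"
    and "\<forall>\<gamma>\<in>value_group v (ratfuns K). \<exists>\<beta>\<in>value_group v (of_const ` K). \<gamma> \<le> \<beta>"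
    and "completion K L w"
    and "krull_valuation (field_on (alg_cl L)) w"
    and "\<forall>c\<in>alg_cl K. w c = v (of_const c)"
    and "complete_sequence K v \<Lambda>"
  shows "complete_sequence L (induced_valuation K v L w) \<Lambda>"
proof -
  have K: "field_set K" and L: "field_set L" and KL: "K \<subseteq> L" and dense: "dense_in K (field_on L) w"
    using assms(1,5) by (auto simp: field_set_iff_subfield completion_def)
  have clK: "alg_closed_set (alg_cl K)" and clL: "alg_closed_set (alg_cl L)"
    using K L by (auto intro: alg_closed_alg_cl)
  have KL_cl: "alg_cl K \<subseteq> alg_cl L" and L_cl: "L \<subseteq> alg_cl L"
    using alg_cl_mono[OF KL] field_set.subset_alg_cl[OF L] by simp_all
  have "field_set (ratfuns (alg_cl K))"
    using clK by (auto intro: field_set_ratfuns simp: alg_closed_set_def)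
  then have "valued_field (ratfuns (alg_cl K)) v"
    using assms(2) valued_field_iff_krull by blast
  with K interpret K: ratfun_valued K v
    by (rule ratfun_valued.intro)
  interpret clL: alg_closed_set "alg_cl L" by (rule clL)
  interpret W: valued_field "alg_cl L" w
    using assms(6) valued_field_iff_krull[OF clL.field_set_axioms] by blast
  obtain a \<gamma> where ag: "(SOME ag. pair_of_definition K v ag) = (a, \<gamma>)"
    by (rule prod.exhaust)
  \<comment> \<open>\<open>induced_valuation\<close> is built from the pair that \<open>SOME\<close>
    selects; existence makes it an actual pair of definition.\<close>
  have pair: "pair_of_definition K v (a, \<gamma>)"
    using someI_ex[OF K.pair_of_definition_exists[OF assms(3)]] unfolding ag .
  note a = K.pair_of_definition_value(1)[OF pair] and G = K.pair_of_definition_value(2)[OF pair]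
  have aL: "a \<in> alg_cl L"
    using a KL_cl by blast
  define u where "u = induced_valuation K v L w"
  have u: "u (to_fract p) = gauss_poly w a \<gamma> p" if "p \<in> polys_over (alg_cl L)" for p
    unfolding u_def induced_valuation_def ag using W.gauss_val_to_fract[OF aL that] by simp
  have "valued_ring (polys_over (alg_cl L)) (\<lambda>p. u (to_fract p))"
    using W.valued_ring_gauss_poly[OF aL] u by (rule valued_ring_cong)
  then interpret U: key_valuation L u
    by (intro key_valuation.intro poly_valued.intro L clL)
  \<comment> \<open>The expansion of p at a has its coefficients in \<open>alg_cl K\<close>, where w
    extends v.\<close>
  have uv: "u (to_fract p) = v (to_fract p)" if p: "p \<in> polys_over (alg_cl K)" for p
  proof -
    have "gauss_poly w a \<gamma> p = gauss_poly K.key.w a \<gamma> p"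
      unfolding gauss_poly_def
    proof (intro arg_cong[of _ _ Min] image_cong refl)
      fix i
      have "Polynomial.coeff (pcompose p [:a, 1:]) i \<in> alg_cl K"
        using K.key.const.pcompose_shift_mem[OF a p] by (rule K.cl.coeff_mem)
      then show "w (Polynomial.coeff (pcompose p [:a, 1:]) i) + Fin (nsmul i \<gamma>) =
          K.key.w (Polynomial.coeff (pcompose p [:a, 1:]) i) + Fin (nsmul i \<gamma>)"
        using assms(7) by (simp add: of_const_def)
    qed
    then show ?thesis
      using u[of p] G[OF p] p polys_over_mono[OF KL_cl] by auto
  qed
  have nonconst: "nonconst_polys K \<subseteq> nonconst_polys L"
    using polys_over_mono[OF KL] by (auto simp: nonconst_polys_def)
  \<comment> \<open>A polynomial over K acquires no new roots in the larger closure, and u agrees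
    with v on its linear factors.\<close>
  have delta_eq: "delta L u f = delta K v f" if f: "f \<in> nonconst_polys K" for f
  proof -
    have root: "b \<in> alg_cl K" if "poly f b = 0" for b
      using f that by (intro K.key.root_mem_alg_cl[of f]) (auto simp: nonconst_polys_def)
    have "u (to_fract [:- b, 1:]) = v (to_fract [:- b, 1:])" if "poly f b = 0" for b
      using uv K.cl.polys_over_linear(1)[OF root[OF that]] by blast
    then have "delta L u f \<le> d \<longleftrightarrow> delta K v f \<le> d" for d
      unfolding U.delta_facts(1)[OF subsetD[OF nonconst f]] K.key.delta_facts(1)[OF f] by simp
    then show ?thesis
      by (meson antisym order_refl)
  qed
  obtain e where e: "e \<in> K" "e \<noteq> 0" "Fin \<gamma> \<le> w e" "0 \<le> w e"
  proof -
    obtain e where "e \<in> K" "e \<noteq> 0" "Fin \<gamma> \<le> v (of_const e)" "0 \<le> v (of_const e)"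
      using K.pair_of_definition_cofinal[OF pair] assms(4) by blast
    then show ?thesis
      using that[of e] bspec[OF assms(7) subsetD[OF K.base.subset_alg_cl]] by simp
  qed
  have dense': "\<exists>y\<in>K. Fin g < w (x - y)" if "x \<in> L" "g \<in> value_group w L" for x g
  proof -
    have "\<exists>y\<in>K. Fin g < w (x \<ominus>\<^bsub>field_on L\<^esub> y)"
      using dense that unfolding dense_in_def by simp
    then obtain y where y: "y \<in> K" "Fin g < w (x \<ominus>\<^bsub>field_on L\<^esub> y)"
      by (elim bexE)
    then show ?thesis
      using field_on_minus[OF L that(1) subsetD[OF KL y(1)]] by (intro bexI[of _ y]) simp_all
  qed
  have approx: "\<exists>g\<in>nonconst_polys K. Polynomial.degree g = Polynomial.degree f \<and> delta L u f \<le> delta K v g"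
    if f: "f \<in> nonconst_polys L" for f
  proof -
    obtain b where b: "b \<in> alg_cl L" "poly f b = 0" "delta L u f = u (to_fract [:- b, 1:])"
      using U.delta_facts(2)[OF f] by blast
    \<comment> \<open>Scaling changes neither the roots nor the degree.\<close>
    define f' where "f' = Polynomial.smult (inverse (Polynomial.lead_coeff f)) f"
    have f': "f' \<in> polys_over L" "Polynomial.lead_coeff f' = 1" "poly f' b = 0"
      "Polynomial.degree f' = Polynomial.degree f"
      using f b(2) unfolding f'_def nonconst_polys_def
      by (auto intro!: U.base.polys_over_smult U.base.inverse_mem U.base.coeff_mem)
    obtain g where g: "g \<in> polys_over K" "Polynomial.lead_coeff g = 1"
        "Polynomial.degree g = Polynomial.degree f" "Fin (nsmul (Polynomial.degree f) \<gamma>) < w (poly g b)"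
      using monic_approximation[OF K L KL W.valued_field_axioms L_cl dense' f'(1,2) b(1) b(1) f'(3)
          subsetD[OF KL e(1)] e(2-4)] f'(4) by auto
    have g_non: "g \<in> nonconst_polys K"
      using g f by (simp add: nonconst_polys_def)
    have gL: "g \<in> polys_over (alg_cl L)" "g \<noteq> 0"
      using g polys_over_mono[OF order_trans[OF KL L_cl]] by auto
    have "\<exists>b'. poly g b' = 0 \<and> Fin \<gamma> < w (b - b')"
    proof (rule ccontr)
      assume "\<not> (\<exists>b'. poly g b' = 0 \<and> Fin \<gamma> < w (b - b'))"
      then have "w (poly g b) \<le> w (Polynomial.lead_coeff g) + Fin (nsmul (Polynomial.degree g) \<gamma>)"
        by (intro root_near[OF clL W.valued_field_axioms b(1) gL]) (meson not_le)
      with g show False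
        by simp
    qed
    then obtain b' where b': "poly g b' = 0" "Fin \<gamma> < w (b - b')"
      by blast
    have b'K: "b' \<in> alg_cl K"
      using g(1) gL(2) b'(1) by (rule K.key.root_mem_alg_cl)
    then have b'L: "b' \<in> alg_cl L"
      using KL_cl by blast
    \<comment> \<open>Passing from b to b' costs only a term of value beyond \<gamma>, so the
      distance from a, cut off at \<gamma>, does not get worse.\<close>
    have "min (w (a - b)) (w (b - b')) \<le> w ((a - b) + (b - b'))"
      using aL b(1) b'L by (intro W.v_add clL.diff_mem)
    then have "min (w (a - b)) (Fin \<gamma>) \<le> min (w (a - b')) (Fin \<gamma>)"
      using b'(2) by (auto simp: min_def split: if_splits)
    then have "u (to_fract [:- b, 1:]) \<le> u (to_fract [:- b', 1:])"
      using u[OF U.linear_mem[OF b(1)]] u[OF U.linear_mem[OF b'L]] by (simp add: W.gauss_poly_linear)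
    also have "\<dots> = v (to_fract [:- b', 1:])"
      using uv K.key.linear_mem[OF b'K] by blast
    also have "\<dots> \<le> delta K v g"
      using b'(1) by (rule K.key.delta_facts(3)[OF g_non])
    finally show ?thesis
      using g_non g(3) b(3) by auto
  qed
  have \<Lambda>: "\<And>Q. Q \<in> \<Lambda> \<Longrightarrow> key_polynomial K v Q" "inj_on (delta K v) \<Lambda>"
    "well_order_on \<Lambda> {(Q, Q'). Q \<in> \<Lambda> \<and> Q' \<in> \<Lambda> \<and> (Q = Q' \<or> delta K v Q < delta K v Q')}"
    "\<And>f. f \<in> nonconst_polys K \<Longrightarrow> \<exists>Q\<in>\<Lambda>. Polynomial.degree Q \<le> Polynomial.degree f \<and>
        v (to_fract f) = truncation K v Q f"
    using assms(8) unfolding complete_sequence_def by blast+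
  have delta_\<Lambda>: "delta L u Q = delta K v Q" if "Q \<in> \<Lambda>" for Q
    using \<Lambda>(1)[OF that] by (intro delta_eq) (simp add: key_polynomial_def)
  have keyL: "key_polynomial L u Q" if Q: "Q \<in> \<Lambda>" for Q
    unfolding key_polynomial_def
  proof (intro conjI ballI impI)
    have key: "key_polynomial K v Q"
      using \<Lambda>(1)[OF Q] .
    then show "Q \<in> nonconst_polys L" "Polynomial.lead_coeff Q = 1"
      using nonconst by (auto simp: key_polynomial_def)
    fix f assume f: "f \<in> nonconst_polys L" "Polynomial.degree f < Polynomial.degree Q"
    obtain g where g: "g \<in> nonconst_polys K" "Polynomial.degree g = Polynomial.degree f"
        "delta L u f \<le> delta K v g"
      using approx[OF f(1)] by blast
    note g(3)
    also have "delta K v g < delta K v Q"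
      using key g f(2) by (simp add: key_polynomial_def)
    finally show "delta L u f < delta L u Q"
      unfolding delta_\<Lambda>[OF Q] .
  qed
  have complete: "\<exists>Q\<in>\<Lambda>. Polynomial.degree Q \<le> Polynomial.degree f \<and> u (to_fract f) = truncation L u Q f"
    if f: "f \<in> nonconst_polys L" for f
  proof -
    obtain g where g: "g \<in> nonconst_polys K" "Polynomial.degree g = Polynomial.degree f"
        "delta L u f \<le> delta K v g"
      using approx[OF f] by blast
    obtain Q where Q: "Q \<in> \<Lambda>" "Polynomial.degree Q \<le> Polynomial.degree g" "v (to_fract g) = truncation K v Q g"
      using \<Lambda>(4)[OF g(1)] by blast
    have "delta K v g \<le> delta K v Q"
      using Q(3) K.key.truncation_eq_iff[OF \<Lambda>(1)[OF Q(1)] g(1)] by blast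
    with g(3) have "delta L u f \<le> delta L u Q"
      unfolding delta_\<Lambda>[OF Q(1)] by (rule order_trans)
    then have "u (to_fract f) = truncation L u Q f"
      using U.truncation_eq_iff[OF keyL[OF Q(1)] f] by blast
    with Q(1,2) g(2) show ?thesis
      by auto
  qed
  have "{(Q, Q'). Q \<in> \<Lambda> \<and> Q' \<in> \<Lambda> \<and> (Q = Q' \<or> delta L u Q < delta L u Q')} =
      {(Q, Q'). Q \<in> \<Lambda> \<and> Q' \<in> \<Lambda> \<and> (Q = Q' \<or> delta K v Q < delta K v Q')}"
    by (auto simp: delta_\<Lambda>)
  moreover have "inj_on (delta L u) \<Lambda>"
    using \<Lambda>(2) by (subst inj_on_cong[of _ _ "delta K v"]) (simp_all add: delta_\<Lambda>)
  ultimately show ?thesis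
    unfolding complete_sequence_def u_def[symmetric] using keyL complete \<Lambda>(3) by simp
qed

end
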